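(* Let $\Gamma\subset\tilde\Gamma\subset \mathrm{SL}(2,\mathbb C)$ be discrete subgroups, both containing $\pm I_2$, such that $\Gamma\backslash\mathbb H^3$ has finite hyperbolic volume and $[\tilde\Gamma:\Gamma]<\infty$. Let $\chi$ be a finite dimensional unitary representation of $\Gamma$ and let $\pi=\mathrm{Ind}_{\Gamma}^{\tilde\Gamma}\chi$ be the induced representation. Then $$z(s;\Gamma;\chi)=z(s;\tilde\Gamma;\pi)$$ for $s\in\mathbb C$, as an identity of meromorphic functions on $\mathbb C$.
   Context: $\mathbb H^3=\mathbb R^2\times(0,\infty)$ is hyperbolic 3-space (upper half-space model) with the standard isometric action of $\mathrm{SL}(2,\mathbb C)$. Let $G\subset\mathrm{SL}(2,\mathbb C)$ be a discrete subgroup containing $\pm I_2$ such that $G\backslash\mathbb H^3$ has finite hyperbolic volume, and let $\rho$ be a finite dimensional unitary representation of $G$. An element $P\in G$ is called hyperbolic if $\mathrm{tr}(P)\notin[-2,2]$ (this includes loxodromic elements). For hyperbolic $P\in G$: - $a(P)$ is the eigenvalue of $P$ with $|a(P)|>1$, and $N(P)=NP=|a(P)|^2$ is the norm of $P$. - The centralizer $C_G(P)$ of $P$ in $G$ is a finitely generated abelian group of rank one; write $C_G(P)=C_G(P)^{\mathrm{free}}\times C_G(P)^{\mathrm{tor}}$ for its decomposition into free and torsion parts. $P_0$ denotes a generator of $C_G(P)^{\mathrm{free}}$ (the primitive hyperbolic element of $P$ in $G$; its norm $NP_0$ does not depend on the choices), and $m(P)=|C_G(P)^{\mathrm{tor}}|$.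 For $\mathrm{Re}(s)>1$ one defines, by an absolutely convergent series, $$z(s;G;\rho)=\sum_{[P]_G}\frac{\mathrm{tr}\,\rho(P)\,\log(NP_0)}{m(P)\,|a(P)-a(P)^{-1}|^2}\,(NP)^{-s},$$ the sum being over the $G$-conjugacy classes $[P]_G$ of hyperbolic elements of $G$. It is known that $z(s;G;\rho)$ has a meromorphic continuation to $s\in\mathbb C$, which is denoted by the same symbol. *)

theory Defs
  imports
    "HOL-Complex_Analysis.Complex_Analysis"
    "HOL-Algebra.Coset"
    "HOL-Algebra.Generated_Groups"
    "HOL-Library.Function_Algebras"
begin

section \<open>The group and its action on hyperbolic space\<close>

type_synonym cmat2 = "complex ^ 2 ^ 2"

definition SL2C :: "cmat2 monoid" where
  "SL2C = \<lparr>carrier = {A. det A = 1}, mult = (**), one = mat 1\<rparr>"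

definition hyp_space :: "(complex \<times> real) set" where
  "hyp_space = {p. snd p > 0}"

text \<open>The Poincare extension of the Moebius action: with \<open>q = z + r j\<close> read as a quaternion
  and \<open>M\<close> having rows \<open>(a, b)\<close> and \<open>(c, d)\<close>, this is \<open>(a q + b) (c q + d)\<inverse>\<close>.\<close>

definition hyp_action :: "cmat2 \<Rightarrow> complex \<times> real \<Rightarrow> complex \<times> real" where
  "hyp_action M p =
     (let a = M $ 1 $ 1; b = M $ 1 $ 2; c = M $ 2 $ 1; d = M $ 2 $ 2; z = fst p; r = snd p;
          D = (cmod (c * z + d))\<^sup>2 + (cmod c)\<^sup>2 * r\<^sup>2
      in (((a * z + b) * cnj (c * z + d) + a * cnj c * of_real (r\<^sup>2)) / of_real D, r / D))"

definition hyp_volume :: "(complex \<times> real) measure" where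
  "hyp_volume = density lborel (\<lambda>p. indicator hyp_space p * ennreal (1 / snd p ^ 3))"

text \<open>As \<open>hyp_space\<close> is open, \<open>F - interior F\<close> is the boundary of \<open>F\<close> relative to
  \<open>hyp_space\<close>. The element \<open>-I\<close> acts trivially, so the second condition compares points,
  not group elements.\<close>

definition fundamental_domain :: "cmat2 set \<Rightarrow> (complex \<times> real) set \<Rightarrow> bool" where
  "fundamental_domain G F \<longleftrightarrow>
     closedin (top_of_set hyp_space) F \<and>
     (\<forall>p\<in>hyp_space. \<exists>g\<in>G. hyp_action g p \<in> F) \<and>
     (\<forall>p\<in>interior F. \<forall>g\<in>G. hyp_action g p \<in> interior F \<longrightarrow> hyp_action g p = p) \<and>
     F - interior F \<in> null_sets lborel"

text \<open>For discrete \<open>G\<close> a fundamental domain exists, and its volume, which does not depend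
  on the choice, is the volume of the quotient.\<close>

definition finite_covolume :: "cmat2 set \<Rightarrow> bool" where
  "finite_covolume G \<longleftrightarrow> (\<exists>F. fundamental_domain G F \<and> emeasure hyp_volume F < \<infinity>)"


section \<open>Finite-dimensional unitary representations\<close>

text \<open>The representation space is a subspace of an ambient complex vector space, rather than a
  whole type, so that induced representations fit. The inner product is linear in the first
  argument.\<close>

record 'v crep =
  rep_scale :: "complex \<Rightarrow> 'v \<Rightarrow> 'v"
  rep_space :: "'v set"
  rep_inner :: "'v \<Rightarrow> 'v \<Rightarrow> complex"
  rep_act :: "cmat2 \<Rightarrow> 'v \<Rightarrow> 'v"

definition hermitian_inner ::
    "(complex \<Rightarrow> 'v::ab_group_add \<Rightarrow> 'v) \<Rightarrow> 'v set \<Rightarrow> ('v \<Rightarrow> 'v \<Rightarrow> complex) \<Rightarrow> bool" where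
  "hermitian_inner smul V ip \<longleftrightarrow>
     (\<forall>u\<in>V. \<forall>v\<in>V. \<forall>w\<in>V. ip (u + v) w = ip u w + ip v w) \<and>
     (\<forall>c. \<forall>u\<in>V. \<forall>v\<in>V. ip (smul c u) v = c * ip u v) \<and>
     (\<forall>u\<in>V. \<forall>v\<in>V. ip v u = cnj (ip u v)) \<and>
     (\<forall>v\<in>V. v \<noteq> 0 \<longrightarrow> ip v v \<in> \<real> \<and> Re (ip v v) > 0)"

definition unitary_rep :: "cmat2 set \<Rightarrow> 'v::ab_group_add crep \<Rightarrow> bool" where
  "unitary_rep G \<rho> \<longleftrightarrow>
     (let smul = rep_scale \<rho>; V = rep_space \<rho>; ip = rep_inner \<rho>; act = rep_act \<rho> in
       vector_space smul \<and> (\<exists>B. finite B \<and> module.span smul B = V) \<and>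
       hermitian_inner smul V ip \<and>
       (\<forall>g\<in>G. \<forall>v\<in>V. act g v \<in> V) \<and>
       (\<forall>g\<in>G. \<forall>u\<in>V. \<forall>v\<in>V. act g (u + v) = act g u + act g v) \<and>
       (\<forall>g\<in>G. \<forall>c. \<forall>v\<in>V. act g (smul c v) = smul c (act g v)) \<and>
       (\<forall>v\<in>V. act (mat 1) v = v) \<and>
       (\<forall>g\<in>G. \<forall>h\<in>G. \<forall>v\<in>V. act (g ** h) v = act g (act h v)) \<and>
       (\<forall>g\<in>G. \<forall>u\<in>V. \<forall>v\<in>V. ip (act g u) (act g v) = ip u v))"

text \<open>Trace of an endomorphism \<open>T\<close> of a finite-dimensional subspace \<open>V\<close>, computed in an
  arbitrary basis.\<close>

definition endo_trace ::
    "(complex \<Rightarrow> 'v::ab_group_add \<Rightarrow> 'v) \<Rightarrow> 'v set \<Rightarrow> ('v \<Rightarrow> 'v) \<Rightarrow> complex" where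
  "endo_trace smul V T =
     (let B = (SOME B. \<not> module.dependent smul B \<and> module.span smul B = V)
      in \<Sum>b\<in>B. module.representation smul B (T b) b)"

definition rep_trace :: "'v::ab_group_add crep \<Rightarrow> cmat2 \<Rightarrow> complex" where
  "rep_trace \<rho> P = endo_trace (rep_scale \<rho>) (rep_space \<rho>) (rep_act \<rho> P)"

text \<open>The representation of \<open>G'\<close> induced from the representation \<open>\<psi>\<close> of \<open>G\<close>: functions
  \<open>f\<close> on \<open>G'\<close> (extended by zero) with \<open>f (h x) = \<psi>(h) f(x)\<close> for \<open>h \<in> G\<close>, on which \<open>G'\<close> acts by
  right translation. If \<open>\<psi>\<close> is unitary, the summand in the inner product does not depend on the
  representative chosen in the coset \<open>C = G x\<close>.\<close>

definition induced_rep ::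
    "cmat2 set \<Rightarrow> cmat2 set \<Rightarrow> 'v::ab_group_add crep \<Rightarrow> (cmat2 \<Rightarrow> 'v) crep" where
  "induced_rep G G' \<psi> =
     \<lparr>rep_scale = (\<lambda>c f x. rep_scale \<psi> c (f x)),
      rep_space = {f. (\<forall>x. x \<notin> G' \<longrightarrow> f x = 0) \<and> (\<forall>x\<in>G'. f x \<in> rep_space \<psi>) \<and>
                      (\<forall>h\<in>G. \<forall>x\<in>G'. f (h ** x) = rep_act \<psi> h (f x))},
      rep_inner = (\<lambda>f f'. \<Sum>C\<in>(rcosets\<^bsub>SL2C\<lparr>carrier := G'\<rparr>\<^esub> G).
                     (let x = (SOME x. x \<in> C) in rep_inner \<psi> (f x) (f' x))),
      rep_act = (\<lambda>g f x. f (x ** g))\<rparr>"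


section \<open>Hyperbolic elements\<close>

definition hyperbolic :: "cmat2 \<Rightarrow> bool" where
  "hyperbolic P \<longleftrightarrow> trace P \<notin> complex_of_real ` {-2..2}"

definition big_eigenvalue :: "cmat2 \<Rightarrow> complex" where
  "big_eigenvalue P = (THE a. (\<exists>v. v \<noteq> 0 \<and> P *v v = a *s v) \<and> cmod a > 1)"

definition hyp_norm :: "cmat2 \<Rightarrow> real" where
  "hyp_norm P = (cmod (big_eigenvalue P))\<^sup>2"

definition centralizer :: "cmat2 set \<Rightarrow> cmat2 \<Rightarrow> cmat2 set" where
  "centralizer G P = {Q \<in> G. Q ** P = P ** Q}"

definition centralizer_tor :: "cmat2 set \<Rightarrow> cmat2 \<Rightarrow> cmat2 set" where
  "centralizer_tor G P = {Q \<in> centralizer G P. \<exists>n::nat. n > 0 \<and> Q [^]\<^bsub>SL2C\<^esub> n = mat 1}"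

text \<open>\<open>P\<^sub>0\<close> generates a free complement of the torsion part of the centralizer of \<open>P\<close>.\<close>

definition is_primitive_of :: "cmat2 set \<Rightarrow> cmat2 \<Rightarrow> cmat2 \<Rightarrow> bool" where
  "is_primitive_of G P P\<^sub>0 \<longleftrightarrow>
     P\<^sub>0 \<in> centralizer G P \<and> P\<^sub>0 \<notin> centralizer_tor G P \<and>
     generate SL2C {P\<^sub>0} \<inter> centralizer_tor G P = {mat 1} \<and>
     generate SL2C {P\<^sub>0} <#>\<^bsub>SL2C\<^esub> centralizer_tor G P = centralizer G P"

definition primitive_norm :: "cmat2 set \<Rightarrow> cmat2 \<Rightarrow> real" where
  "primitive_norm G P = hyp_norm (SOME P\<^sub>0. is_primitive_of G P P\<^sub>0)"

definition conj_class :: "cmat2 set \<Rightarrow> cmat2 \<Rightarrow> cmat2 set" where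
  "conj_class G P = (\<lambda>h. h ** P ** inv\<^bsub>SL2C\<^esub> h) ` G"

definition hyperbolic_classes :: "cmat2 set \<Rightarrow> cmat2 set set" where
  "hyperbolic_classes G = conj_class G ` {P \<in> G. hyperbolic P}"


section \<open>The function \<open>z(s; G; \<rho>)\<close>\<close>

definition z_term :: "cmat2 set \<Rightarrow> 'v::ab_group_add crep \<Rightarrow> complex \<Rightarrow> cmat2 \<Rightarrow> complex" where
  "z_term G \<rho> s P =
     rep_trace \<rho> P * of_real (ln (primitive_norm G P)) /
     of_real (real (card (centralizer_tor G P)) *
              (cmod (big_eigenvalue P - inverse (big_eigenvalue P)))\<^sup>2) *
     of_real (hyp_norm P) powr (- s)"

definition z_class_term ::
    "cmat2 set \<Rightarrow> 'v::ab_group_add crep \<Rightarrow> complex \<Rightarrow> cmat2 set \<Rightarrow> complex" where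
  "z_class_term G \<rho> s C = z_term G \<rho> s (SOME P. P \<in> C)"

definition z_series :: "cmat2 set \<Rightarrow> 'v::ab_group_add crep \<Rightarrow> complex \<Rightarrow> complex" where
  "z_series G \<rho> s = (\<Sum>\<^sub>\<infinity>C\<in>hyperbolic_classes G. z_class_term G \<rho> s C)"

text \<open>\<open>nicely_meromorphic_on\<close> normalises a meromorphic function (removable singularities are
  removed, the value at a pole is 0), so that equality of meromorphic functions is equality of
  functions and the continuation is unique.\<close>

definition is_z_continuation ::
    "cmat2 set \<Rightarrow> 'v::ab_group_add crep \<Rightarrow> (complex \<Rightarrow> complex) \<Rightarrow> bool" where
  "is_z_continuation G \<rho> Z \<longleftrightarrow>
     Z nicely_meromorphic_on UNIV \<and> (\<forall>s. Re s > 1 \<longrightarrow> Z s = z_series G \<rho> s)"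

definition z_fun :: "cmat2 set \<Rightarrow> 'v::ab_group_add crep \<Rightarrow> complex \<Rightarrow> complex" where
  "z_fun G \<rho> = (THE Z. is_z_continuation G \<rho> Z)"

definition z_well_defined :: "cmat2 set \<Rightarrow> 'v::ab_group_add crep \<Rightarrow> bool" where
  "z_well_defined G \<rho> \<longleftrightarrow>
     (\<forall>s. Re s > 1 \<longrightarrow> (\<lambda>C. norm (z_class_term G \<rho> s C)) summable_on hyperbolic_classes G) \<and>
     (\<exists>Z. is_z_continuation G \<rho> Z)"

lemma is_z_continuation_unique:
  assumes "is_z_continuation G \<rho> Z" "is_z_continuation G \<rho> W"
  shows "Z = W"
proof
  fix w :: complex
  have nZ: "Z nicely_meromorphic_on UNIV" and nW: "W nicely_meromorphic_on UNIV"
    and eq: "\<And>s. Re s > 1 \<Longrightarrow> Z s = W s"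
    using assms by (auto simp: is_z_continuation_def)
  then have mero: "(\<lambda>s. Z s - W s) meromorphic_on UNIV"
    by (auto simp: nicely_meromorphic_on_def intro!: meromorphic_intros)
  have "(\<forall>\<^sub>\<approx>x\<in>UNIV. Z x - W x = 0) \<or> (\<forall>\<^sub>\<approx>x\<in>UNIV. Z x - W x \<noteq> 0)"
    by (rule meromorphic_imp_constant_or_avoid[OF mero]) auto
  moreover have "\<not> (\<forall>\<^sub>\<approx>x\<in>UNIV. Z x - W x \<noteq> 0)"
  proof
    assume "\<forall>\<^sub>\<approx>x\<in>UNIV. Z x - W x \<noteq> 0"
    then have "\<forall>\<^sub>F x in at (2::complex). Z x - W x \<noteq> 0"
      by (auto simp: eventually_cosparse_open_eq)
    moreover have "\<forall>\<^sub>F x in at (2::complex). Re x > 1"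
      using eventually_at_in_open'[OF open_halfspace_Re_gt[of 1], of 2] by simp
    ultimately have "\<forall>\<^sub>F x in at (2::complex). False"
      by eventually_elim (use eq in auto)
    then show False by simp
  qed
  ultimately have "\<forall>\<^sub>\<approx>x\<in>UNIV. Z x - W x = 0" by blast
  then have ev: "\<forall>\<^sub>F x in at w. Z x = W x"
    by (auto simp: eventually_cosparse_open_eq)
  have "is_pole Z w \<longleftrightarrow> is_pole W w"
    by (rule is_pole_cong[OF ev refl])
  moreover have "Z \<midarrow>w\<rightarrow> l \<longleftrightarrow> W \<midarrow>w\<rightarrow> l" for l
    by (rule tendsto_cong[OF ev])
  ultimately show "Z w = W w"
    using nZ nW is_pole_zero_at_nicely_mero unfolding nicely_meromorphic_on_def
    by (metis UNIV_I LIM_unique not_tendsto_and_filterlim_at_infinity at_neq_bot is_pole_def)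
qed

end

theory Submission
  imports Defs
begin

text \<open>
  Group the \<open>\<Gamma>\<close>-classes of hyperbolic elements according to the \<open>\<Gamma>'\<close>-class that contains
  them. Every \<open>\<Gamma>'\<close>-class \<open>[P]\<close> receives only finitely many \<open>\<Gamma>\<close>-classes, and the theorem
  follows if the term of \<open>[P]\<close> in the series for the induced representation \<open>\<pi>\<close> is the sum
  of the terms of these \<open>\<Gamma>\<close>-classes in the series for \<open>\<psi>\<close>
  (\<open>z_term_induced\<close>). The triangle inequality then transfers absolute convergence to
  \<open>\<Gamma>'\<close>, summation by blocks gives the equality of the two series on \<open>Re s > 1\<close>
  (\<open>z_series_induced\<close>), and equal series have the same meromorphic continuations.

  For one class, Frobenius' formula (\<open>rep_trace_induced\<close>) gives
  \<open>tr \<pi>(P) = \<Sum> tr \<psi>(x P x\<inverse>)\<close>, the sum being over the cosets \<open>\<Gamma> x\<close> in \<open>\<Gamma>'\<close> with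
  \<open>x P x\<inverse> \<in> \<Gamma>\<close>. The summand depends only on the \<open>\<Gamma>\<close>-class of \<open>x P x\<inverse>\<close>. The cosets
  that yield the class of a given \<open>Q\<close> correspond to the cosets of the centralizer
  \<open>C(\<Gamma>, Q)\<close> in \<open>C(\<Gamma>', Q)\<close>, so the class of \<open>Q\<close> is hit \<open>[C(\<Gamma>', Q) : C(\<Gamma>, Q)]\<close> times.
  The factors \<open>N(Q)\<close> and \<open>a(Q)\<close> are common to all these elements, and
  what is left to check is (\<open>card_cosets_over_class\<close>)
  \<open>[C(\<Gamma>', Q) : C(\<Gamma>, Q)] \<sqdot> log N(P\<^sub>0) / m(P) = log N(Q\<^sub>0) / m(Q)\<close>,
  where \<open>P\<^sub>0\<close> and \<open>m(P)\<close> refer to \<open>\<Gamma>'\<close>, and \<open>Q\<^sub>0\<close> and \<open>m(Q)\<close> to \<open>\<Gamma>\<close>.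

  This is a statement about covolumes. Diagonalising \<open>Q\<close> identifies its centralizer in
  \<open>SL(2, \<complex>)\<close> with the multiplicative group of nonzero complex numbers, so \<open>C(\<Gamma>, Q)\<close> becomes a
  discrete group \<open>\<Lambda>\<close> of dilations of the plane. Such a group is generated by its elements of
  modulus one, which form the torsion part, and one element \<open>c\<close> of least modulus
  greater than one, which is the primitive element. The annulus \<open>1 \<le> |z| < |c|\<close> contains exactly
  \<open>m\<close> points of each orbit of \<open>\<Lambda>\<close>. Counting the points of the larger group in this
  annulus in two ways gives the index formula (\<open>dilation_group_index\<close>).
\<close>

(* Both formal power series and vectors use this infix symbol; matrices of nested
   vectors otherwise have exponentially many parses. *)
no_notation fps_nth (infixl \<open>$\<close> 75)

section \<open>Discrete groups of dilations of the plane\<close>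

text \<open>The image of the centralizer of a hyperbolic element under diagonalisation. The assumption
  \<open>isolated\<close> is discreteness at \<open>1\<close>, which homogeneity carries to every other element.\<close>

locale discrete_dilation_group =
  fixes \<Lambda> :: "complex set"
  assumes one: "1 \<in> \<Lambda>"
    and nonzero: "0 \<notin> \<Lambda>"
    and mult: "x \<in> \<Lambda> \<Longrightarrow> y \<in> \<Lambda> \<Longrightarrow> x * y \<in> \<Lambda>"
    and inverse: "x \<in> \<Lambda> \<Longrightarrow> inverse x \<in> \<Lambda>"
    and isolated: "\<exists>e>0. \<forall>x\<in>\<Lambda>. cmod (x - 1) < e \<longrightarrow> x = 1"
    and dilation: "\<exists>x\<in>\<Lambda>. cmod x > 1"
begin

definition unit_part :: "complex set" where
  "unit_part = {x \<in> \<Lambda>. cmod x = 1}"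

definition least_dilation :: "complex \<Rightarrow> bool" where
  "least_dilation c \<longleftrightarrow> c \<in> \<Lambda> \<and> cmod c > 1 \<and> (\<forall>x\<in>\<Lambda>. cmod x > 1 \<longrightarrow> cmod c \<le> cmod x)"

lemma nonzeroD: "x \<in> \<Lambda> \<Longrightarrow> x \<noteq> 0"
  using nonzero by auto

lemma power: "x \<in> \<Lambda> \<Longrightarrow> x ^ n \<in> \<Lambda>"
  by (induction n) (auto intro: one mult)

lemma powi: "x \<in> \<Lambda> \<Longrightarrow> x powi k \<in> \<Lambda>"
  by (auto simp: power_int_def intro: power inverse)

lemma divide: "x \<in> \<Lambda> \<Longrightarrow> y \<in> \<Lambda> \<Longrightarrow> x / y \<in> \<Lambda>"
  by (simp add: divide_inverse mult inverse)

text \<open>If \<open>1\<close> has distance at least \<open>e\<close> from the other elements, then \<open>x \<noteq> y\<close> with \<open>|y| \<ge> 1\<close>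
  satisfy \<open>|x - y| = |y| |x / y - 1| \<ge> e\<close>. A bounded set with uniformly separated points is
  finite.\<close>

lemma finite_annulus: "finite {x \<in> \<Lambda>. 1 \<le> cmod x \<and> cmod x \<le> R}" (is "finite ?S")
proof -
  obtain e where e: "e > 0" "\<And>x. x \<in> \<Lambda> \<Longrightarrow> cmod (x - 1) < e \<Longrightarrow> x = 1"
    using isolated by blast
  have "uniform_discrete ?S"
    unfolding uniform_discrete_def
  proof (intro exI conjI ballI impI)
    fix x y assume x: "x \<in> ?S" and y: "y \<in> ?S" and d: "dist x y < e"
    have y0: "y \<noteq> 0" using y nonzero by auto
    then have "x / y - 1 = (x - y) / y" by (simp add: field_simps)
    then have "cmod (x / y - 1) = dist x y / cmod y"
      by (simp add: norm_divide dist_norm)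
    also have "\<dots> \<le> dist x y"
      using y mult_right_mono[of 1 "cmod y" "dist x y"] y0
      by (simp add: field_simps)
    finally have "cmod (x / y - 1) < e" using d by simp
    then have "x / y = 1" using e(2) divide x y by blast
    then show "x = y" using y0 by simp
  qed (rule e)
  moreover have "bounded ?S"
    by (rule boundedI[of _ R]) auto
  ultimately show ?thesis by (simp flip: uniform_discrete_finite_iff)
qed

lemma finite_unit_part: "finite unit_part"
  by (rule finite_subset[OF _ finite_annulus[of 1]]) (auto simp: unit_part_def)

lemma card_unit_part_pos: "card unit_part > 0"
  using finite_unit_part one by (auto simp: card_gt_0_iff unit_part_def)

text \<open>Two powers of an element of the finite set \<open>unit_part\<close> coincide.\<close>

lemma unit_part_iff_finite_order: "x \<in> unit_part \<longleftrightarrow> x \<in> \<Lambda> \<and> (\<exists>n>0. x ^ n = 1)"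
proof safe
  assume x: "x \<in> unit_part"
  then show "x \<in> \<Lambda>" by (simp add: unit_part_def)
  have "range (\<lambda>n. x ^ n) \<subseteq> unit_part"
    using x by (auto simp: unit_part_def norm_power power)
  then have "\<not> inj (\<lambda>n::nat. x ^ n)"
    using finite_unit_part finite_subset finite_imageD infinite_UNIV_nat by blast
  then obtain m n :: nat where mn: "m < n" "x ^ m = x ^ n"
    by (metis injI nat_neq_iff)
  have "x ^ n = x ^ m * x ^ (n - m)" using mn(1) by (simp flip: power_add)
  then have "x ^ (n - m) = 1" using mn nonzeroD[OF \<open>x \<in> \<Lambda>\<close>] by simp
  then show "\<exists>n>0. x ^ n = 1" using mn(1) by (intro exI[of _ "n - m"]) simp
next
  fix n :: nat assume "x \<in> \<Lambda>" "n > 0" "x ^ n = 1"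
  then have "cmod x ^ n = 1" by (metis norm_one norm_power)
  then have "cmod x = 1" using \<open>n > 0\<close> by (metis norm_ge_zero power_eq_1_iff real_norm_def abs_of_nonneg neq0_conv)
  then show "x \<in> unit_part" using \<open>x \<in> \<Lambda>\<close> by (simp add: unit_part_def)
qed

lemma least_dilation_exists: obtains c where "least_dilation c"
proof -
  obtain b where b: "b \<in> \<Lambda>" "cmod b > 1" using dilation by blast
  let ?S = "{x \<in> \<Lambda>. 1 < cmod x \<and> cmod x \<le> cmod b}"
  have fin: "finite ?S" by (rule finite_subset[OF _ finite_annulus[of "cmod b"]]) auto
  have ne: "?S \<noteq> {}" using b by auto
  let ?c = "arg_min_on cmod ?S"
  have c: "?c \<in> ?S" using arg_min_if_finite(1)[OF fin ne] .
  have m: "cmod ?c \<le> cmod x" if "x \<in> ?S" for x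
    using arg_min_least[OF fin ne that] .
  have "least_dilation ?c"
    unfolding least_dilation_def
  proof (intro conjI ballI impI)
    fix x assume "x \<in> \<Lambda>" "cmod x > 1"
    then show "cmod ?c \<le> cmod x" using m[of x] c by (cases "cmod x \<le> cmod b") auto
  qed (use c in auto)
  then show ?thesis by (rule that)
qed

end

lemma powi_between:
  fixes r z :: real
  assumes "r > 1" "z > 0"
  obtains k :: int where "r powi k \<le> z" "z < r powi (k + 1)"
proof -
  define k where "k = \<lfloor>log r z\<rfloor>"
  have p: "r powi j = r powr of_int j" for j
    using assms by (simp add: powr_real_of_int')
  have "r powr of_int k \<le> r powr (log r z)"
    using assms unfolding k_def by (intro powr_mono) auto
  moreover have "r powr (log r z) < r powr of_int (k + 1)"
    using assms unfolding k_def by (intro powr_less_mono) linarith+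
  ultimately show ?thesis using assms by (intro that[of k]) (auto simp: p)
qed

context discrete_dilation_group
begin

text \<open>Division with remainder: dividing \<open>x\<close> by the largest power of \<open>c\<close> not exceeding it in
  modulus leaves an element of modulus in \<open>[1, |c|)\<close>, which has modulus \<open>1\<close> as \<open>c\<close> is least.\<close>

lemma cyclic_decomposition:
  assumes c: "least_dilation c" and x: "x \<in> \<Lambda>"
  obtains k t where "t \<in> unit_part" "x = c powi k * t"
proof -
  have c': "c \<in> \<Lambda>" "cmod c > 1" "\<And>y. y \<in> \<Lambda> \<Longrightarrow> cmod y > 1 \<Longrightarrow> cmod c \<le> cmod y"
    using c by (auto simp: least_dilation_def)
  have nz: "x \<noteq> 0" "c \<noteq> 0" using x c' nonzero by auto
  obtain k where k: "cmod c powi k \<le> cmod x" "cmod x < cmod c powi (k + 1)"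
    using powi_between[OF c'(2)] nz by (metis zero_less_norm_iff)
  define t where "t = x / c powi k"
  have t: "t \<in> \<Lambda>" unfolding t_def by (intro divide powi x c')
  have pos: "cmod c powi k > 0" using nz by (simp add: zero_less_power_int)
  have "cmod t = cmod x / cmod c powi k" by (simp add: t_def norm_divide norm_power_int)
  moreover have "cmod c powi (k + 1) = cmod c * cmod c powi k"
    using nz by (simp add: power_int_add)
  ultimately have t_bounds: "1 \<le> cmod t" "cmod t < cmod c"
    using k pos by (simp_all add: pos_divide_less_eq)
  moreover have "\<not> 1 < cmod t" using c'(3)[OF t] t_bounds(2) by (meson not_le)
  ultimately have "cmod t = 1" by linarith
  with t have "t \<in> unit_part" by (simp add: unit_part_def)
  moreover have "x = c powi k * t" using nz by (simp add: t_def)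
  ultimately show ?thesis by (rule that)
qed

text \<open>The half-open annulus \<open>1 \<le> |w| < |c|\<close> is a fundamental domain for multiplication by the
  powers of \<open>c\<close>. Hence it meets the orbit of \<open>z\<close> in one translate of \<open>unit_part\<close>.\<close>

lemma card_shifted_annulus:
  assumes c: "least_dilation c" and z: "z \<noteq> 0"
  shows "card {x \<in> \<Lambda>. 1 \<le> cmod (x * z) \<and> cmod (x * z) < cmod c} = card unit_part"
proof -
  have c': "c \<in> \<Lambda>" "cmod c > 1" using c by (auto simp: least_dilation_def)
  have nz: "c \<noteq> 0" using c' nonzero by auto
  obtain k where k: "cmod c powi k \<le> cmod z" "cmod z < cmod c powi (k + 1)"
    using powi_between[OF c'(2)] z by (metis zero_less_norm_iff)
  have pos: "cmod c powi k > 0" using nz by (simp add: zero_less_power_int)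
  \<comment> \<open>The only power of \<open>c\<close> that moves \<open>z\<close> into the annulus is the one with exponent \<open>- k\<close>.\<close>
  have "{x \<in> \<Lambda>. 1 \<le> cmod (x * z) \<and> cmod (x * z) < cmod c} = (\<lambda>t. c powi (-k) * t) ` unit_part"
    (is "?A = ?B")
  proof (intro equalityI subsetI)
    fix x assume x: "x \<in> ?A"
    then obtain j t where jt: "t \<in> unit_part" "x = c powi j * t"
      using cyclic_decomposition[OF c] by blast
    have nx: "cmod (x * z) = cmod c powi j * cmod z"
      using jt by (simp add: unit_part_def norm_mult norm_power_int)
    have posj: "cmod c powi j > 0" using nz by (simp add: zero_less_power_int)
    have "cmod c powi j * cmod c powi k \<le> cmod c powi j * cmod z"
      using k posj by simp
    also have "\<dots> < cmod c powi 1" using x nx by simp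
    finally have "cmod c powi (j + k) < cmod c powi 1" using nz by (simp add: power_int_add)
    then have "j + k < 1" using c'(2) by (meson linorder_not_less power_int_increasing less_imp_le)
    moreover have "cmod c powi 0 \<le> cmod c powi j * cmod z" using x nx by simp
    then have "cmod c powi 0 < cmod c powi j * cmod c powi (k + 1)"
      using k posj by (smt (verit) mult_strict_left_mono)
    then have "cmod c powi 0 < cmod c powi (j + k + 1)"
      using nz by (simp add: power_int_add algebra_simps)
    then have "0 < j + k + 1" using c'(2) by (meson linorder_not_less power_int_increasing less_imp_le)
    ultimately have "j = - k" by simp
    then show "x \<in> ?B" using jt by auto
  next
    fix x assume "x \<in> ?B"
    then obtain t where t: "t \<in> unit_part" "x = c powi (-k) * t" by auto
    have "cmod (x * z) = cmod z / cmod c powi k"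
      using t by (simp add: unit_part_def norm_mult norm_power_int norm_inverse power_int_minus
          divide_inverse)
    moreover have "x \<in> \<Lambda>" using t c' by (auto simp: unit_part_def intro!: mult powi)
    ultimately show "x \<in> ?A" using k pos nz
      by (simp add: power_int_add pos_le_divide_eq pos_divide_less_eq mult.commute del: norm_mult)
  qed
  moreover have "inj_on (\<lambda>t. c powi (-k) * t) unit_part"
    using nz by (auto simp: inj_on_def)
  ultimately show ?thesis by (simp add: card_image)
qed

text \<open>The annulus \<open>|c|\<^sup>n \<le> |x| < |c|\<^sup>n\<^sup>+\<^sup>1\<close> added in each step is a translate of the fundamental one.\<close>

lemma card_annulus:
  assumes c: "least_dilation c"
  shows "card {x \<in> \<Lambda>. 1 \<le> cmod x \<and> cmod x < cmod c ^ n} = n * card unit_part"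
proof (induction n)
  case 0
  have "{x \<in> \<Lambda>. 1 \<le> cmod x \<and> cmod x < cmod c ^ 0} = {}" by auto
  then show ?case by (simp only: card.empty mult_0)
next
  case (Suc n)
  have c': "c \<in> \<Lambda>" "cmod c > 1" using c by (auto simp: least_dilation_def)
  have nz: "c \<noteq> 0" using c' nonzero by auto
  have ge1: "1 \<le> cmod c ^ n" using c' by simp
  let ?A = "\<lambda>n. {x \<in> \<Lambda>. 1 \<le> cmod x \<and> cmod x < cmod c ^ n}"
  let ?B = "{x \<in> \<Lambda>. 1 \<le> cmod (x * inverse (c ^ n)) \<and> cmod (x * inverse (c ^ n)) < cmod c}"
  have fin: "finite (?A k)" for k
    by (rule finite_subset[OF _ finite_annulus[of "cmod c ^ k"]]) auto
  have eq: "?B = {x \<in> \<Lambda>. cmod c ^ n \<le> cmod x \<and> cmod x < cmod c ^ Suc n}"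
    using nz by (auto simp: norm_mult norm_inverse norm_power norm_divide field_simps)
  have un: "?A (Suc n) = ?A n \<union> ?B"
  proof -
    have "cmod c ^ n < cmod c ^ Suc n" using c' by (intro power_strict_increasing) auto
    then show ?thesis using ge1 unfolding eq by (smt (verit) Collect_cong Un_def mem_Collect_eq)
  qed
  have "finite ?B" using fin[of "Suc n"] un by simp
  moreover have "?A n \<inter> ?B = {}" unfolding eq by auto
  ultimately have "card (?A (Suc n)) = card (?A n) + card ?B"
    unfolding un using fin by (intro card_Un_disjoint) auto
  then show ?case using Suc card_shifted_annulus[OF c, of "inverse (c ^ n)"] nz by simp
qed

end

text \<open>The map \<open>\<phi>\<close> stands for any encoding of the cosets of \<open>\<Lambda>\<close> in \<open>\<Lambda>'\<close>, so the first factor is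
  the index. Let \<open>|c| = |c'|\<^sup>n\<close>. The fundamental annulus \<open>D\<close> of \<open>\<Lambda>\<close> contains
  \<open>n m'\<close> elements of \<open>\<Lambda>'\<close>, and \<open>m\<close> elements of every coset, where \<open>m\<close> and \<open>m'\<close> are the
  orders of the unit parts. Hence the index times \<open>m\<close> equals \<open>n m'\<close>.\<close>

lemma dilation_group_index:
  assumes "discrete_dilation_group \<Lambda>" and "discrete_dilation_group \<Lambda>'" and sub: "\<Lambda> \<subseteq> \<Lambda>'"
    and c: "discrete_dilation_group.least_dilation \<Lambda> c"
    and c': "discrete_dilation_group.least_dilation \<Lambda>' c'"
    and \<phi>: "\<And>x y. x \<in> \<Lambda>' \<Longrightarrow> y \<in> \<Lambda>' \<Longrightarrow> \<phi> x = \<phi> y \<longleftrightarrow> x / y \<in> \<Lambda>"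
  shows "real (card (\<phi> ` \<Lambda>')) *
           (ln (cmod c') / real (card (discrete_dilation_group.unit_part \<Lambda>'))) =
         ln (cmod c) / real (card (discrete_dilation_group.unit_part \<Lambda>))"
proof -
  interpret L: discrete_dilation_group \<Lambda> by fact
  interpret L': discrete_dilation_group \<Lambda>' by fact
  have c1: "c \<in> \<Lambda>" "cmod c > 1" "c' \<in> \<Lambda>'" "cmod c' > 1"
    using c c' by (auto simp: L.least_dilation_def L'.least_dilation_def)
  obtain k t where kt: "t \<in> L'.unit_part" "c = c' powi k * t"
    using L'.cyclic_decomposition[OF c'] c1 sub by blast
  have nc: "cmod c = cmod c' powi k"
    using kt by (simp add: L'.unit_part_def norm_mult norm_power_int)
  have "k > 0"
  proof (rule ccontr)
    assume "\<not> k > 0"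
    then have "cmod c' powi k \<le> cmod c' powi 0" using c1 by (intro power_int_increasing) auto
    then show False using nc c1 by simp
  qed
  then obtain n where n: "k = int n" "n > 0"
    by (metis zero_less_imp_eq_int)
  have ncn: "cmod c = cmod c' ^ n" using nc n by (simp add: power_int_def)
  define D where "D = {x \<in> \<Lambda>'. 1 \<le> cmod x \<and> cmod x < cmod c}"
  have finD: "finite D"
    unfolding D_def by (rule finite_subset[OF _ L'.finite_annulus[of "cmod c"]]) auto
  have fibre: "{y \<in> D. \<phi> y = \<phi> x} = (\<lambda>w. w * x) ` {w \<in> \<Lambda>. 1 \<le> cmod (w * x) \<and> cmod (w * x) < cmod c}"
    (is "?F = ?G") if x: "x \<in> \<Lambda>'" for x
  proof (intro equalityI subsetI)
    fix y assume y: "y \<in> ?F"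
    then have "y / x \<in> \<Lambda>" using \<phi>[of y x] x by (auto simp: D_def)
    then show "y \<in> ?G" using y L'.nonzeroD[OF x] by (intro image_eqI[of _ _ "y / x"]) (auto simp: D_def)
  next
    fix y assume "y \<in> ?G"
    then obtain w where w: "w \<in> \<Lambda>" "y = w * x" "1 \<le> cmod (w * x)" "cmod (w * x) < cmod c" by auto
    then have "y \<in> D" using sub x by (auto simp: D_def intro: L'.mult)
    moreover have "\<phi> y = \<phi> x"
      using w sub x L'.nonzeroD[OF x] by (subst \<phi>) (auto intro: L'.mult)
    ultimately show "y \<in> ?F" by simp
  qed
  have cardF: "card {y \<in> D. \<phi> y = \<phi> x} = card L.unit_part" if x: "x \<in> \<Lambda>'" for x
    unfolding fibre[OF x] using L'.nonzeroD[OF x] L.card_shifted_annulus[OF c, of x]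
    by (subst card_image) (auto simp: inj_on_def)
  have img: "\<phi> ` D = \<phi> ` \<Lambda>'"
  proof (intro equalityI subsetI)
    fix u assume "u \<in> \<phi> ` \<Lambda>'"
    then obtain x where x: "x \<in> \<Lambda>'" "u = \<phi> x" by auto
    have "card {y \<in> D. \<phi> y = \<phi> x} \<noteq> 0" using cardF[OF x(1)] L.card_unit_part_pos by simp
    then have "{y \<in> D. \<phi> y = \<phi> x} \<noteq> {}" by (metis card.empty)
    then obtain y where "y \<in> D" "\<phi> y = u" using x by blast
    then show "u \<in> \<phi> ` D" by blast
  qed (auto simp: D_def)
  have "card D = (\<Sum>u\<in>\<phi> ` D. card {y \<in> D. \<phi> y = u})"
    using sum_fun_comp[OF finD finite_imageI[OF finD] subset_refl, of "\<lambda>_. 1::nat" \<phi>] by simp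
  also have "\<dots> = (\<Sum>u\<in>\<phi> ` D. card L.unit_part)"
    using cardF by (intro sum.cong) (auto simp: img)
  finally have "card D = card (\<phi> ` \<Lambda>') * card L.unit_part" by (simp add: img)
  moreover have "card D = n * card L'.unit_part"
    unfolding D_def ncn by (rule L'.card_annulus[OF c'])
  ultimately have "real (card (\<phi> ` \<Lambda>')) * real (card L.unit_part) = real n * real (card L'.unit_part)"
    by (metis of_nat_mult)
  moreover have "ln (cmod c) = real n * ln (cmod c')"
    using c1 by (simp add: ncn ln_realpow)
  ultimately show ?thesis
    using L.card_unit_part_pos L'.card_unit_part_pos by (simp add: field_simps)
qed

section \<open>Matrices of determinant one\<close>

lemma SL2C_simps [simp]:
  "A \<in> carrier SL2C \<longleftrightarrow> det A = 1" "A \<otimes>\<^bsub>SL2C\<^esub> B = A ** B" "\<one>\<^bsub>SL2C\<^esub> = mat 1"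
  by (auto simp: SL2C_def)

lemma group_SL2C: "group SL2C"
proof (rule groupI)
  fix A assume A: "A \<in> carrier SL2C"
  then have "invertible A" by (simp add: invertible_det_nz)
  then obtain B where B: "A ** B = mat 1" "B ** A = mat 1" by (auto simp: invertible_def)
  then have "det A * det B = 1" by (metis det_I det_mul)
  then show "\<exists>B\<in>carrier SL2C. B \<otimes>\<^bsub>SL2C\<^esub> A = \<one>\<^bsub>SL2C\<^esub>" using A B by (intro bexI[of _ B]) auto
qed (auto simp: det_mul matrix_mul_assoc)

interpretation SL2C: group SL2C by (rule group_SL2C)

lemma SL2C_inv:
  assumes "det A = 1"
  shows "det (inv\<^bsub>SL2C\<^esub> A) = 1" "A ** inv\<^bsub>SL2C\<^esub> A = mat 1" "inv\<^bsub>SL2C\<^esub> A ** A = mat 1"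
  using SL2C.inv_closed[of A] SL2C.r_inv[of A] SL2C.l_inv[of A] assms by auto

lemma SL2C_inv_cancel:
  assumes "det A = 1"
  shows "A ** (inv\<^bsub>SL2C\<^esub> A ** B) = B" "inv\<^bsub>SL2C\<^esub> A ** (A ** B) = B"
    "B ** A ** inv\<^bsub>SL2C\<^esub> A = B" "B ** inv\<^bsub>SL2C\<^esub> A ** A = B"
  using SL2C_inv[OF assms] by (simp_all add: matrix_mul_assoc) (simp_all flip: matrix_mul_assoc)

lemma SL2C_inv_mult:
  assumes "det A = 1" "det B = 1"
  shows "inv\<^bsub>SL2C\<^esub> (A ** B) = inv\<^bsub>SL2C\<^esub> B ** inv\<^bsub>SL2C\<^esub> A"
  using SL2C.inv_mult_group[of A B] assms by simp

lemma SL2C_inv_inv: "det A = 1 \<Longrightarrow> inv\<^bsub>SL2C\<^esub> (inv\<^bsub>SL2C\<^esub> A) = A"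
  using SL2C.inv_inv[of A] by simp

lemma trace_conj:
  assumes "det A = 1"
  shows "trace (A ** P ** inv\<^bsub>SL2C\<^esub> A) = trace P"
  by (subst trace_mul_sym) (simp add: SL2C_inv_cancel assms)

section \<open>Diagonalisation of hyperbolic matrices\<close>

definition diag2 :: "complex \<Rightarrow> cmat2" where
  "diag2 c = vector [vector [c, 0], vector [0, inverse c]]"

definition diag_conj :: "cmat2 \<Rightarrow> complex \<Rightarrow> cmat2" where
  "diag_conj S c = S ** diag2 c ** inv\<^bsub>SL2C\<^esub> S"

lemma mat2_eq_iff:
  fixes A B :: cmat2
  shows "A = B \<longleftrightarrow> ((A $ 1 $ 1 = B $ 1 $ 1) \<and> (A $ 1 $ 2 = B $ 1 $ 2)) \<and>
                     ((A $ 2 $ 1 = B $ 2 $ 1) \<and> (A $ 2 $ 2 = B $ 2 $ 2))"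
  by (simp add: vec_eq_iff forall_2)

lemma mat2_mult_nth:
  "((A :: cmat2) ** B) $ i $ j = A $ i $ 1 * B $ 1 $ j + A $ i $ 2 * B $ 2 $ j"
  by (simp add: matrix_matrix_mult_def sum_2)

lemma mat2_one_nth:
  "(mat 1 :: cmat2) $ 1 $ 1 = 1" "(mat 1 :: cmat2) $ 1 $ 2 = 0"
  "(mat 1 :: cmat2) $ 2 $ 1 = 0" "(mat 1 :: cmat2) $ 2 $ 2 = 1"
  by (simp_all add: mat_def)

lemma diag2_nth:
  "diag2 c $ 1 $ 1 = c" "diag2 c $ 1 $ 2 = 0" "diag2 c $ 2 $ 1 = 0" "diag2 c $ 2 $ 2 = inverse c"
  by (simp_all add: diag2_def)

lemma diag2_mult: "diag2 (c * d) = diag2 c ** diag2 d"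
  by (simp add: mat2_eq_iff mat2_mult_nth diag2_nth)

lemma diag2_1: "diag2 1 = mat 1"
  by (simp add: mat2_eq_iff mat2_one_nth diag2_nth)

lemma det_diag2: "c \<noteq> 0 \<Longrightarrow> det (diag2 c) = 1"
  by (simp add: det_2 diag2_nth)

lemma diag2_eq_iff: "diag2 c = diag2 d \<longleftrightarrow> c = d"
  by (metis diag2_nth(1))

text \<open>The eigenvalues \<open>a\<close>, \<open>b\<close> have product \<open>1\<close> and sum \<open>tr P\<close>. If both had modulus one, then
  \<open>b\<close> would be the conjugate of \<open>a\<close> and the trace \<open>2 Re a\<close> would lie in \<open>[-2, 2]\<close>. So one of them has
  modulus greater than one, the two are distinct, and there is a basis of eigenvectors.\<close>

lemma hyperbolic_diagonalizable:
  assumes "hyperbolic P" and det: "det P = 1"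
  obtains S a where "det S = 1" "cmod a > 1" "P = diag_conj S a"
proof -
  define p q r s where "p = P $ 1 $ 1" "q = P $ 1 $ 2" "r = P $ 2 $ 1" "s = P $ 2 $ 2"
  note pqrs = this
  have tr: "trace P = p + s" by (simp add: trace_def sum_2 pqrs)
  have dt: "p * s - q * r = 1" using det by (simp add: det_2 pqrs)
  obtain a b where ab: "a + b = p + s" "a * b = 1" "cmod a > 1"
  proof -
    define x y where "x = (p + s + csqrt ((p + s)\<^sup>2 - 4)) / 2" "y = (p + s - csqrt ((p + s)\<^sup>2 - 4)) / 2"
    note xy = this
    have sum: "x + y = p + s" by (simp add: xy field_simps)
    have "4 * (x * y) = (p + s)\<^sup>2 - (csqrt ((p + s)\<^sup>2 - 4))\<^sup>2"
      by (simp add: xy field_simps power2_eq_square)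
    then have prod: "x * y = 1" by simp
    have nx: "cmod x * cmod y = 1" using prod by (metis norm_mult norm_one)
    have "cmod x \<noteq> 1"
    proof
      assume x1: "cmod x = 1"
      then have "x * cnj x = 1" by (simp add: complex_norm_square[symmetric])
      then have "y = cnj x" using prod by (metis mult_cancel_left mult_zero_left zero_neq_one)
      then have "p + s = complex_of_real (2 * Re x)" using sum complex_add_cnj by metis
      moreover have "\<bar>Re x\<bar> \<le> 1" using x1 abs_Re_le_cmod[of x] by simp
      ultimately have "p + s \<in> complex_of_real ` {-2..2}" by (intro image_eqI[of _ _ "2 * Re x"]) auto
      then show False using assms(1) tr by (simp add: hyperbolic_def)
    qed
    moreover have "cmod y > 1" if "cmod x < 1"
    proof (rule ccontr)
      assume "\<not> cmod y > 1"
      then have "cmod x * cmod y \<le> cmod x * 1" by (intro mult_left_mono) auto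
      then show False using nx that by simp
    qed
    ultimately show ?thesis
      using that[of x y] that[of y x] sum prod by (metis add.commute linorder_neqE mult.commute)
  qed
  have a0: "a \<noteq> 0" using ab by auto
  have b: "b = inverse a" using ab(2) a0 by (simp add: field_simps)
  have "a \<noteq> b"
  proof
    assume "a = b"
    then have "cmod a * cmod a = 1" using ab(2) by (metis norm_mult norm_one)
    moreover have "cmod a * cmod a > 1 * 1" using ab(3) by (intro mult_strict_mono) auto
    ultimately show False by simp
  qed
  \<comment> \<open>Both eigenvalues are roots of the characteristic polynomial.\<close>
  have char: "(a - p) * (a - s) = q * r" "(b - p) * (b - s) = q * r"
  proof -
    have "(a - p) * (a - s) = a * a - a * (p + s) + p * s" by (simp add: algebra_simps)
    also have "\<dots> = p * s - a * b" by (simp flip: ab(1) add: algebra_simps)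
    finally show "(a - p) * (a - s) = q * r" using dt ab(2) by (simp add: algebra_simps)
    have "(b - p) * (b - s) = b * b - b * (p + s) + p * s" by (simp add: algebra_simps)
    also have "\<dots> = p * s - a * b" by (simp flip: ab(1) add: algebra_simps)
    finally show "(b - p) * (b - s) = q * r" using dt ab(2) by (simp add: algebra_simps)
  qed
  \<comment> \<open>Eigenvectors \<open>v\<close> and \<open>w\<close> are read off from a row of \<open>P - a\<close> and \<open>P - b\<close> that is not zero.\<close>
  obtain v1 v2 w1 w2 where vw: "v1 * w2 - w1 * v2 \<noteq> 0"
    "p * v1 + q * v2 = a * v1" "r * v1 + s * v2 = a * v2"
    "p * w1 + q * w2 = b * w1" "r * w1 + s * w2 = b * w2"
  proof (cases "q = 0")
    case False
    show ?thesis
    proof (rule that[of q "b - p" q "a - p"])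
      have "q * (b - p) - q * (a - p) = q * (b - a)" by (simp add: algebra_simps)
      then show "q * (b - p) - q * (a - p) \<noteq> 0" using False \<open>a \<noteq> b\<close> by simp
    qed (use char in \<open>simp_all add: algebra_simps\<close>)
  next
    case q: True
    show ?thesis
    proof (cases "r = 0")
      case False
      show ?thesis
      proof (rule that[of "a - s" r "b - s" r])
        have "(a - s) * r - (b - s) * r = (a - b) * r" by (simp add: algebra_simps)
        then show "(a - s) * r - (b - s) * r \<noteq> 0" using False \<open>a \<noteq> b\<close> by simp
      qed (use char q in \<open>simp_all add: algebra_simps\<close>)
    next
      case r: True
      from char(1) q r consider "p = a" | "s = a" by auto
      then show ?thesis
      proof cases
        case 1
        then show ?thesis using that[of 1 1 0 0] ab(1) q r by simp
      next
        case 2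
        then show ?thesis using that[of 0 0 1 1] ab(1) q r by simp
      qed
    qed
  qed
  define d where "d = v1 * w2 - w1 * v2"
  have d: "d \<noteq> 0" using vw by (simp add: d_def)
  \<comment> \<open>Dividing one eigenvector by \<open>d\<close> normalises the determinant.\<close>
  define S :: cmat2 where "S = vector [vector [v1 / d, w1], vector [v2 / d, w2]]"
  have Sn: "S $ 1 $ 1 = v1 / d" "S $ 1 $ 2 = w1" "S $ 2 $ 1 = v2 / d" "S $ 2 $ 2 = w2"
    by (simp_all add: S_def)
  have "det S = (v1 * w2 - w1 * v2) / d" by (simp add: det_2 Sn diff_divide_distrib)
  then have detS: "det S = 1" using d by (simp add: d_def)
  have "P ** S = S ** diag2 a"
  proof -
    have "p * (v1 / d) + q * (v2 / d) = v1 / d * a" "r * (v1 / d) + s * (v2 / d) = v2 / d * a"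
      using vw by (simp_all flip: add_divide_distrib add: mult.commute)
    moreover have "p * w1 + q * w2 = w1 * b" "r * w1 + s * w2 = w2 * b"
      using vw by (simp_all add: mult.commute)
    ultimately show ?thesis
      by (simp add: mat2_eq_iff mat2_mult_nth diag2_nth Sn b flip: pqrs)
  qed
  then have "P = diag_conj S a"
    unfolding diag_conj_def by (metis SL2C_inv_cancel(3)[OF detS])
  then show ?thesis using that detS ab(3) by blast
qed

context
  fixes S :: cmat2
  assumes S: "det S = 1"
begin

lemma diag_conj_mult: "diag_conj S (c * d) = diag_conj S c ** diag_conj S d"
  by (simp add: diag_conj_def diag2_mult matrix_mul_assoc SL2C_inv_cancel[OF S])

lemma diag_conj_1: "diag_conj S 1 = mat 1"
  by (simp add: diag_conj_def diag2_1 SL2C_inv[OF S])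

lemma det_diag_conj: "c \<noteq> 0 \<Longrightarrow> det (diag_conj S c) = 1"
  by (simp add: diag_conj_def det_mul det_diag2 SL2C_inv S)

lemma diag_conj_inverse: "c \<noteq> 0 \<Longrightarrow> diag_conj S (inverse c) = inv\<^bsub>SL2C\<^esub> (diag_conj S c)"
  using SL2C.inv_equality[of "diag_conj S (inverse c)" "diag_conj S c"]
  by (simp add: det_diag_conj diag_conj_1 flip: diag_conj_mult)

lemma diag_conj_eq_iff: "diag_conj S c = diag_conj S d \<longleftrightarrow> c = d"
  unfolding diag_conj_def by (metis S SL2C_inv_cancel(2,4) diag2_eq_iff matrix_mul_assoc)

lemma diag_conj_power: "diag_conj S c [^]\<^bsub>SL2C\<^esub> (n::nat) = diag_conj S (c ^ n)"
  by (induction n) (simp_all add: diag_conj_1 mult.commute flip: diag_conj_mult)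

lemma diag_conj_powi:
  assumes "c \<noteq> 0"
  shows "diag_conj S c [^]\<^bsub>SL2C\<^esub> (k::int) = diag_conj S (c powi k)"
proof (cases "k \<ge> 0")
  case True
  then show ?thesis by (simp add: int_pow_def2 power_int_def diag_conj_power)
next
  case False
  then show ?thesis
    using assms by (simp add: int_pow_def2 power_int_def diag_conj_power flip: diag_conj_inverse)
      (simp add: power_inverse)
qed

text \<open>In the eigenbasis, a matrix commuting with \<open>diag2 a\<close>, whose diagonal entries differ, is
  diagonal; its determinant being \<open>1\<close>, it is \<open>diag2\<close> of its first entry.\<close>

lemma commute_diag_conj_iff:
  assumes a: "cmod a > 1" and A: "det A = 1"
  shows "A ** diag_conj S a = diag_conj S a ** A \<longleftrightarrow> (\<exists>c. c \<noteq> 0 \<and> A = diag_conj S c)"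
proof
  assume comm: "A ** diag_conj S a = diag_conj S a ** A"
  define B where "B = inv\<^bsub>SL2C\<^esub> S ** A ** S"
  have A_eq: "A = S ** B ** inv\<^bsub>SL2C\<^esub> S"
    by (simp add: B_def matrix_mul_assoc SL2C_inv_cancel[OF S] SL2C_inv[OF S])
  have "B ** diag2 a = inv\<^bsub>SL2C\<^esub> S ** (A ** diag_conj S a) ** S"
    by (simp add: B_def diag_conj_def matrix_mul_assoc SL2C_inv_cancel[OF S])
  also have "\<dots> = inv\<^bsub>SL2C\<^esub> S ** (diag_conj S a ** A) ** S" by (simp only: comm)
  also have "\<dots> = diag2 a ** B"
    by (simp add: B_def diag_conj_def matrix_mul_assoc SL2C_inv_cancel[OF S] SL2C_inv[OF S])
  finally have eq: "B ** diag2 a = diag2 a ** B" .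
  have a0: "a \<noteq> 0" using a by auto
  have "inverse a \<noteq> a"
  proof
    assume "inverse a = a"
    then have "cmod a * cmod a = 1"
      by (metis a0 left_inverse norm_mult norm_one)
    moreover have "cmod a * cmod a > 1 * 1" using a by (intro mult_strict_mono) auto
    ultimately show False by simp
  qed
  then have off: "B $ 1 $ 2 = 0" "B $ 2 $ 1 = 0"
    using eq by (auto simp: mat2_eq_iff mat2_mult_nth diag2_nth mult.commute)
  have "det B = 1" by (simp add: B_def det_mul A S SL2C_inv)
  then have "B $ 1 $ 1 * B $ 2 $ 2 = 1" by (simp add: det_2 off)
  then have "B $ 1 $ 1 \<noteq> 0" "B $ 2 $ 2 = inverse (B $ 1 $ 1)"
    by (auto simp: inverse_unique)
  then have "B = diag2 (B $ 1 $ 1)" by (simp add: mat2_eq_iff diag2_nth off)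
  then show "\<exists>c. c \<noteq> 0 \<and> A = diag_conj S c"
    using A_eq \<open>B $ 1 $ 1 \<noteq> 0\<close> unfolding diag_conj_def by metis
next
  assume "\<exists>c. c \<noteq> 0 \<and> A = diag_conj S c"
  then show "A ** diag_conj S a = diag_conj S a ** A"
    by (metis diag_conj_mult mult.commute)
qed

lemma big_eigenvalue_diag_conj:
  assumes c: "cmod c > 1"
  shows "big_eigenvalue (diag_conj S c) = c"
  unfolding big_eigenvalue_def
proof (rule the_equality)
  define e :: "complex ^ 2" where "e = axis 1 1"
  have e: "e $ 1 = 1" "e $ 2 = 0" by (simp_all add: e_def axis_def)
  have "diag2 c *v e = c *s e"
    by (simp add: vec_eq_iff forall_2 matrix_vector_mult_def sum_2 diag2_nth e)
  then have "diag_conj S c *v (S *v e) = c *s (S *v e)"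
    by (simp add: diag_conj_def matrix_vector_mul_assoc SL2C_inv_cancel[OF S])
      (simp flip: matrix_vector_mul_assoc add: vector_scalar_commute)
  moreover have "S *v e \<noteq> 0"
  proof
    assume "S *v e = 0"
    then have "inv\<^bsub>SL2C\<^esub> S *v (S *v e) = 0" by simp
    then have "e = 0" by (simp add: matrix_vector_mul_assoc SL2C_inv[OF S])
    then show False using e by simp
  qed
  ultimately show "(\<exists>v. v \<noteq> 0 \<and> diag_conj S c *v v = c *s v) \<and> cmod c > 1" using c by blast
next
  fix x assume x: "(\<exists>v. v \<noteq> 0 \<and> diag_conj S c *v v = x *s v) \<and> cmod x > 1"
  then obtain v where v: "v \<noteq> 0" "diag_conj S c *v v = x *s v" by blast
  define u where "u = inv\<^bsub>SL2C\<^esub> S *v v"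
  have Su: "S *v u = v" by (simp add: u_def matrix_vector_mul_assoc SL2C_inv[OF S])
  have "diag2 c *v u = inv\<^bsub>SL2C\<^esub> S *v (diag_conj S c *v v)"
    by (simp add: u_def diag_conj_def matrix_vector_mul_assoc matrix_mul_assoc SL2C_inv[OF S])
  also have "\<dots> = x *s u" by (simp add: v(2) u_def vector_scalar_commute)
  finally have eq: "c * u $ 1 = x * u $ 1" "inverse c * u $ 2 = x * u $ 2"
    by (simp_all add: vec_eq_iff forall_2 matrix_vector_mult_def sum_2 diag2_nth)
  have "inverse c \<noteq> x"
  proof
    assume "inverse c = x"
    then have "inverse (cmod c) > 1" using x by (metis norm_inverse)
    then show False using c by (simp add: one_less_inverse_iff)
  qed
  then have "u $ 2 = 0" using eq(2) by auto
  moreover have "u \<noteq> 0" using Su v(1) by auto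
  ultimately have "u $ 1 \<noteq> 0" by (auto simp: vec_eq_iff forall_2)
  then show "x = c" using eq(1) by auto
qed

end

text \<open>A generator of the free part of a centralizer may contract the eigenvector that \<open>P\<close>
  expands, so the norm is also computed for the inverse parameter. Exchanging the two eigenvectors
  by the Weyl element \<open>W\<close> reduces this to the first case.\<close>

lemma hyp_norm_diag_conj:
  assumes S: "det S = 1" and c: "cmod c > 1"
  shows "hyp_norm (diag_conj S c) = (cmod c)\<^sup>2" "hyp_norm (diag_conj S (inverse c)) = (cmod c)\<^sup>2"
proof -
  show "hyp_norm (diag_conj S c) = (cmod c)\<^sup>2"
    by (simp add: hyp_norm_def big_eigenvalue_diag_conj[OF S c])
  define W :: cmat2 where "W = vector [vector [0, -1], vector [1, 0]]"
  have Wn: "W $ 1 $ 1 = 0" "W $ 1 $ 2 = -1" "W $ 2 $ 1 = 1" "W $ 2 $ 2 = 0" by (simp_all add: W_def)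
  have W: "det W = 1" by (simp add: det_2 Wn)
  have "W ** diag2 c = diag2 (inverse c) ** W"
    by (simp add: mat2_eq_iff mat2_mult_nth diag2_nth Wn)
  then have "diag_conj (S ** W) c = diag_conj S (inverse c)"
    by (simp add: diag_conj_def SL2C_inv_mult[OF S W] matrix_mul_assoc)
      (metis SL2C_inv_cancel(3)[OF W] matrix_mul_assoc)
  moreover have "det (S ** W) = 1" by (simp add: det_mul S W)
  ultimately show "hyp_norm (diag_conj S (inverse c)) = (cmod c)\<^sup>2"
    by (metis big_eigenvalue_diag_conj c hyp_norm_def)
qed

section \<open>Centralizers of hyperbolic elements\<close>

definition diag_params :: "cmat2 set \<Rightarrow> cmat2 \<Rightarrow> complex set" where
  "diag_params G S = {c. c \<noteq> 0 \<and> diag_conj S c \<in> G}"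

locale hyperbolic_torus =
  fixes G :: "cmat2 set" and S :: cmat2 and a :: complex
  assumes subgroup: "subgroup G SL2C" and discrete: "discrete G"
    and S: "det S = 1" and a: "cmod a > 1" and in_G: "diag_conj S a \<in> G"
begin

sublocale discrete_dilation_group "diag_params G S"
proof
  show "1 \<in> diag_params G S"
    using subgroup.one_closed[OF subgroup] by (simp add: diag_params_def diag_conj_1 S)
  show "0 \<notin> diag_params G S" by (simp add: diag_params_def)
  show "x * y \<in> diag_params G S" if "x \<in> diag_params G S" "y \<in> diag_params G S" for x y
    using that subgroup.m_closed[OF subgroup] by (auto simp: diag_params_def diag_conj_mult S)
  show "inverse x \<in> diag_params G S" if "x \<in> diag_params G S" for x
    using that subgroup.m_inv_closed[OF subgroup] by (auto simp: diag_params_def diag_conj_inverse S)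
  show "\<exists>x\<in>diag_params G S. 1 < cmod x"
    using a in_G by (intro bexI[of _ a]) (auto simp: diag_params_def)
  have "mat 1 \<in> G" using subgroup.one_closed[OF subgroup] by simp
  then obtain T where T: "open T" "T \<inter> G = {mat 1}"
    using discrete by (auto simp: discrete_def isolated_in_def)
  \<comment> \<open>Discreteness of \<open>G\<close> at the identity matrix is pulled back along the parametrisation.\<close>
  have "isCont (diag_conj S) 1"
    unfolding isCont_def
  proof (intro vec_tendstoI)
    fix i j
    show "((\<lambda>c. diag_conj S c $ i $ j) \<longlongrightarrow> diag_conj S 1 $ i $ j) (at 1)"
      unfolding diag_conj_def mat2_mult_nth diag2_nth by (intro tendsto_intros) simp_all
  qed
  then have "\<forall>\<^sub>F c in at 1. diag_conj S c \<in> T"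
    using T by (auto simp: isCont_def diag_conj_1 S intro!: topological_tendstoD)
  then obtain e where e: "e > 0" "\<And>c. c \<noteq> 1 \<Longrightarrow> dist c 1 < e \<Longrightarrow> diag_conj S c \<in> T"
    by (auto simp: eventually_at)
  show "\<exists>e>0. \<forall>x\<in>diag_params G S. cmod (x - 1) < e \<longrightarrow> x = 1"
  proof (intro exI conjI ballI impI)
    fix x assume x: "x \<in> diag_params G S" "cmod (x - 1) < e"
    show "x = 1"
    proof (rule ccontr)
      assume "x \<noteq> 1"
      then have "diag_conj S x \<in> T \<inter> G" using x e(2)[of x] by (auto simp: diag_params_def dist_norm)
      then have "diag_conj S x = diag_conj S 1" using T by (simp add: diag_conj_1 S)
      then show False using \<open>x \<noteq> 1\<close> by (simp add: diag_conj_eq_iff S)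
    qed
  qed (rule e(1))
qed

abbreviation P where "P \<equiv> diag_conj S a"

lemma centralizer_eq: "centralizer G P = diag_conj S ` diag_params G S"
proof -
  have "det A = 1" if "A \<in> G" for A using subgroup.subset[OF subgroup] that by auto
  then show ?thesis
    using commute_diag_conj_iff[OF S a] by (auto simp: centralizer_def diag_params_def)
qed

lemma centralizer_tor_eq: "centralizer_tor G P = diag_conj S ` unit_part"
proof -
  have "diag_conj S c [^]\<^bsub>SL2C\<^esub> n = mat 1 \<longleftrightarrow> c ^ n = 1" for c and n :: nat
    by (metis S diag_conj_1 diag_conj_eq_iff diag_conj_power)
  moreover have "unit_part = {c \<in> diag_params G S. \<exists>n>0. c ^ n = 1}"
    using unit_part_iff_finite_order by blast
  ultimately show ?thesis
    unfolding centralizer_tor_def centralizer_eq by auto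
qed

lemma card_centralizer_tor: "card (centralizer_tor G P) = card unit_part"
  unfolding centralizer_tor_eq by (rule card_image) (simp add: inj_on_def diag_conj_eq_iff S)

lemma generate_diag_conj:
  assumes "c \<noteq> 0"
  shows "generate SL2C {diag_conj S c} = range (\<lambda>k::int. diag_conj S (c powi k))"
  using SL2C.generate_pow[of "diag_conj S c"] assms
  by (auto simp: diag_conj_powi det_diag_conj S)

text \<open>This shows that primitive elements exist, so that the choice in \<open>primitive_norm\<close> is meaningful.\<close>

lemma is_primitive_of_least_dilation:
  assumes c: "least_dilation c"
  shows "is_primitive_of G P (diag_conj S c)"
proof -
  have c': "c \<in> diag_params G S" "cmod c > 1" using c by (auto simp: least_dilation_def)
  have nz: "c \<noteq> 0" using nonzeroD[OF c'(1)] .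
  have "c powi k \<in> unit_part \<Longrightarrow> c powi k = 1" for k :: int
  proof -
    assume "c powi k \<in> unit_part"
    then have "cmod c powi k = cmod c powi 0" by (simp add: unit_part_def norm_power_int)
    then have "k = 0" using c'(2) nz power_int_strict_increasing[of 0 k "cmod c"]
        power_int_strict_increasing[of k 0 "cmod c"] by (metis less_irrefl linorder_neqE)
    then show ?thesis by simp
  qed
  moreover have "1 \<in> unit_part" using one by (simp add: unit_part_def)
  ultimately have "generate SL2C {diag_conj S c} \<inter> centralizer_tor G P = {mat 1}"
    unfolding centralizer_tor_eq generate_diag_conj[OF nz]
    by (auto simp: diag_conj_eq_iff S simp flip: diag_conj_1[OF S] intro: range_eqI[of _ _ 0])
  moreover have "generate SL2C {diag_conj S c} <#>\<^bsub>SL2C\<^esub> centralizer_tor G P = centralizer G P"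
  proof -
    have "diag_conj S x \<in> range (\<lambda>k::int. diag_conj S (c powi k)) <#>\<^bsub>SL2C\<^esub> diag_conj S ` unit_part"
      if x: "x \<in> diag_params G S" for x
    proof -
      obtain k t where "t \<in> unit_part" "x = c powi k * t" using cyclic_decomposition[OF c x] .
      then show ?thesis by (auto simp: set_mult_def diag_conj_mult S)
    qed
    moreover have "c powi k * t \<in> diag_params G S" if "t \<in> unit_part" for k t
      using that c' by (auto simp: unit_part_def intro: mult powi)
    ultimately show ?thesis
      unfolding centralizer_tor_eq generate_diag_conj[OF nz] centralizer_eq
      by (auto simp: set_mult_def simp flip: diag_conj_mult[OF S])
  qed
  moreover have "diag_conj S c \<notin> centralizer_tor G P"
    using c' by (auto simp: centralizer_tor_eq diag_conj_eq_iff S unit_part_def)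
  ultimately show ?thesis
    using c' by (auto simp: is_primitive_of_def centralizer_eq)
qed

text \<open>Primitive elements are unique up to inversion and torsion, neither of which changes the norm:
  writing \<open>c\<close> and the parameter \<open>x\<close> of \<open>P\<^sub>0\<close> through each other up to units gives
  \<open>|c|\<^sup>j\<^sup>k = |c|\<close>, hence \<open>j = 1\<close> or \<open>j = -1\<close>.\<close>

lemma hyp_norm_primitive:
  assumes c: "least_dilation c" and P0: "is_primitive_of G P P\<^sub>0"
  shows "hyp_norm P\<^sub>0 = (cmod c)\<^sup>2"
proof -
  have c': "c \<in> diag_params G S" "cmod c > 1" using c by (auto simp: least_dilation_def)
  have nz: "c \<noteq> 0" using nonzeroD[OF c'(1)] .
  obtain x where x: "x \<in> diag_params G S" "P\<^sub>0 = diag_conj S x"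
    using P0 by (auto simp: is_primitive_of_def centralizer_eq)
  have x0: "x \<noteq> 0" using nonzeroD[OF x(1)] .
  have "diag_conj S c \<in> generate SL2C {P\<^sub>0} <#>\<^bsub>SL2C\<^esub> centralizer_tor G P"
    using P0 c' by (auto simp: is_primitive_of_def centralizer_eq)
  then obtain k t where kt: "t \<in> unit_part" "c = x powi k * t"
    unfolding x(2) generate_diag_conj[OF x0] centralizer_tor_eq
    by (auto simp: set_mult_def diag_conj_eq_iff S simp flip: diag_conj_mult[OF S])
  obtain j u where ju: "u \<in> unit_part" "x = c powi j * u"
    using cyclic_decomposition[OF c x(1)] .
  have nx: "cmod x = cmod c powi j" using ju by (simp add: unit_part_def norm_mult norm_power_int)
  have "cmod c = cmod x powi k" using kt by (simp add: unit_part_def norm_mult norm_power_int)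
  then have eq: "cmod c powi (j * k) = cmod c powi 1" by (simp add: nx power_int_mult)
  have "j * k = 1"
    using c'(2) eq power_int_strict_increasing[of "j * k" 1 "cmod c"]
      power_int_strict_increasing[of 1 "j * k" "cmod c"] by (metis less_irrefl linorder_neqE)
  then have "j = 1 \<or> j = -1" by (auto simp: zmult_eq_1_iff)
  then show ?thesis
  proof
    assume "j = 1"
    then show ?thesis using nx c'(2) hyp_norm_diag_conj(1)[OF S, of x] by (simp add: x(2))
  next
    assume "j = -1"
    then have nx': "cmod (inverse x) = cmod c" using nx nz by (simp add: norm_inverse)
    then show ?thesis using c'(2) hyp_norm_diag_conj(2)[OF S, of "inverse x"] by (simp add: x(2))
  qed
qed

lemma primitive_norm_eq:
  assumes "least_dilation c"
  shows "primitive_norm G P = (cmod c)\<^sup>2"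
  unfolding primitive_norm_def
  using is_primitive_of_least_dilation[OF assms] hyp_norm_primitive[OF assms] by (metis someI)

end

section \<open>Cosets and conjugacy classes\<close>

abbreviation (input) right_cosets :: "cmat2 set \<Rightarrow> cmat2 set \<Rightarrow> cmat2 set set" where
  "right_cosets G G' \<equiv> rcosets\<^bsub>SL2C\<lparr>carrier := G'\<rparr>\<^esub> G"

definition rcos :: "cmat2 set \<Rightarrow> cmat2 \<Rightarrow> cmat2 set" where
  "rcos G y = (\<lambda>h. h ** y) ` G"

lemma right_cosets_eq: "right_cosets G G' = rcos G ` G'"
  by (auto simp: RCOSETS_def r_coset_def rcos_def SL2C_def)

lemma subgroup_SL2C:
  assumes "subgroup G SL2C"
  shows "g \<in> G \<Longrightarrow> det g = 1" "mat 1 \<in> G" "g \<in> G \<Longrightarrow> h \<in> G \<Longrightarrow> g ** h \<in> G"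
    "g \<in> G \<Longrightarrow> inv\<^bsub>SL2C\<^esub> g \<in> G"
  using subgroup.subset[OF assms] subgroup.one_closed[OF assms] subgroup.m_closed[OF assms]
    subgroup.m_inv_closed[OF assms] by auto

lemma mem_rcos_iff:
  assumes G: "subgroup G SL2C" and y: "det y = 1"
  shows "x \<in> rcos G y \<longleftrightarrow> x ** inv\<^bsub>SL2C\<^esub> y \<in> G"
proof
  assume "x ** inv\<^bsub>SL2C\<^esub> y \<in> G"
  then show "x \<in> rcos G y"
    unfolding rcos_def by (rule image_eqI[rotated]) (simp add: SL2C_inv_cancel[OF y])
qed (auto simp: rcos_def SL2C_inv_cancel[OF y])

lemma rcos_eq_iff:
  assumes G: "subgroup G SL2C" and x: "det x = 1" and y: "det y = 1"
  shows "rcos G x = rcos G y \<longleftrightarrow> x ** inv\<^bsub>SL2C\<^esub> y \<in> G"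
proof
  assume eq: "rcos G x = rcos G y"
  have "x \<in> rcos G x" using subgroup_SL2C(2)[OF G] by (simp add: mem_rcos_iff[OF G x] SL2C_inv[OF x])
  then show "x ** inv\<^bsub>SL2C\<^esub> y \<in> G" using eq mem_rcos_iff[OF G y] by simp
next
  assume xy: "x ** inv\<^bsub>SL2C\<^esub> y \<in> G"
  have yx: "y ** inv\<^bsub>SL2C\<^esub> x \<in> G"
    using subgroup_SL2C(4)[OF G xy] by (simp add: SL2C_inv_mult x y SL2C_inv SL2C_inv_inv)
  show "rcos G x = rcos G y"
  proof (intro equalityI subsetI)
    fix z assume "z \<in> rcos G x"
    then have "(z ** inv\<^bsub>SL2C\<^esub> x) ** (x ** inv\<^bsub>SL2C\<^esub> y) \<in> G"
      using subgroup_SL2C(3)[OF G _ xy] by (simp add: mem_rcos_iff[OF G x])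
    then show "z \<in> rcos G y" by (simp add: mem_rcos_iff[OF G y] matrix_mul_assoc SL2C_inv_cancel[OF x])
  next
    fix z assume "z \<in> rcos G y"
    then have "(z ** inv\<^bsub>SL2C\<^esub> y) ** (y ** inv\<^bsub>SL2C\<^esub> x) \<in> G"
      using subgroup_SL2C(3)[OF G _ yx] by (simp add: mem_rcos_iff[OF G y])
    then show "z \<in> rcos G x" by (simp add: mem_rcos_iff[OF G x] matrix_mul_assoc SL2C_inv_cancel[OF y])
  qed
qed

lemma rcos_self: "subgroup G SL2C \<Longrightarrow> y \<in> rcos G y"
  unfolding rcos_def by (rule image_eqI[of _ _ "mat 1"]) (simp_all add: subgroup_SL2C)

lemma mem_conj_class: "subgroup G SL2C \<Longrightarrow> det P = 1 \<Longrightarrow> P \<in> conj_class G P"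
  using SL2C.inv_one unfolding conj_class_def
  by (intro image_eqI[of _ _ "mat 1"]) (auto simp: subgroup_SL2C)

lemma conj_conj:
  assumes "det g = 1" "det h = 1"
  shows "g ** (h ** P ** inv\<^bsub>SL2C\<^esub> h) ** inv\<^bsub>SL2C\<^esub> g = (g ** h) ** P ** inv\<^bsub>SL2C\<^esub> (g ** h)"
  using assms by (simp add: SL2C_inv_mult matrix_mul_assoc)

lemma conj_class_conj:
  assumes G: "subgroup G SL2C" and h: "h \<in> G"
  shows "conj_class G (h ** P ** inv\<^bsub>SL2C\<^esub> h) = conj_class G P"
proof (intro equalityI subsetI)
  note d = subgroup_SL2C(1)[OF G]
  fix Q assume "Q \<in> conj_class G (h ** P ** inv\<^bsub>SL2C\<^esub> h)"
  then obtain g where g: "g \<in> G" "Q = g ** (h ** P ** inv\<^bsub>SL2C\<^esub> h) ** inv\<^bsub>SL2C\<^esub> g"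
    by (auto simp: conj_class_def)
  then show "Q \<in> conj_class G P"
    using subgroup_SL2C(3)[OF G g(1) h] conj_conj[OF d d, OF g(1) h] by (auto simp: conj_class_def)
next
  note d = subgroup_SL2C(1)[OF G]
  fix Q assume "Q \<in> conj_class G P"
  then obtain g where g: "g \<in> G" "Q = g ** P ** inv\<^bsub>SL2C\<^esub> g" by (auto simp: conj_class_def)
  let ?k = "g ** inv\<^bsub>SL2C\<^esub> h"
  have k: "?k \<in> G" using subgroup_SL2C[OF G] g h by auto
  have "Q = ?k ** (h ** P ** inv\<^bsub>SL2C\<^esub> h) ** inv\<^bsub>SL2C\<^esub> ?k"
    unfolding conj_conj[OF d d, OF k h] by (simp add: g SL2C_inv_cancel[OF d[OF h]])
  then show "Q \<in> conj_class G (h ** P ** inv\<^bsub>SL2C\<^esub> h)"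
    using k by (auto simp: conj_class_def)
qed

lemma conj_class_eqI:
  assumes "subgroup G SL2C" "Q \<in> conj_class G P"
  shows "conj_class G Q = conj_class G P"
proof -
  obtain h where "h \<in> G" "Q = h ** P ** inv\<^bsub>SL2C\<^esub> h" using assms(2) by (auto simp: conj_class_def)
  then show ?thesis using conj_class_conj[OF assms(1)] by simp
qed

section \<open>Traces of representations\<close>

text \<open>The vectors \<open>e i\<close> and functionals \<open>\<phi> i\<close> form a resolution of the identity of \<open>V\<close>. If
  \<open>B\<close> is the basis chosen in \<open>endo_trace\<close>, with coordinate functionals \<open>b\<^sup>*\<close>, expanding
  \<open>b = \<Sum>\<^sub>i \<phi>\<^sub>i(b) e\<^sub>i\<close> and then \<open>T e\<^sub>i = \<Sum>\<^sub>b b\<^sup>*(T e\<^sub>i) b\<close> turns \<open>\<Sum>\<^sub>b b\<^sup>*(T b)\<close> into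
  \<open>\<Sum>\<^sub>i \<phi>\<^sub>i(T e\<^sub>i)\<close>. This form covers changes of basis as well as the induced representation.\<close>

lemma endo_trace_eq_sum:
  fixes smul :: "complex \<Rightarrow> 'v::ab_group_add \<Rightarrow> 'v"
  assumes vs: "vector_space smul" and V: "module.subspace smul V" and I: "finite I"
    and e: "\<And>i. i \<in> I \<Longrightarrow> e i \<in> V"
    and resolution: "\<And>v. v \<in> V \<Longrightarrow> v = (\<Sum>i\<in>I. smul (\<phi> i v) (e i))"
    and T: "\<And>v. v \<in> V \<Longrightarrow> T v \<in> V"
    and T_add: "\<And>u v. u \<in> V \<Longrightarrow> v \<in> V \<Longrightarrow> T (u + v) = T u + T v"
    and T_scale: "\<And>c v. v \<in> V \<Longrightarrow> T (smul c v) = smul c (T v)"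
    and \<phi>_add: "\<And>i u v. i \<in> I \<Longrightarrow> u \<in> V \<Longrightarrow> v \<in> V \<Longrightarrow> \<phi> i (u + v) = \<phi> i u + \<phi> i v"
    and \<phi>_scale: "\<And>i c v. i \<in> I \<Longrightarrow> v \<in> V \<Longrightarrow> \<phi> i (smul c v) = c * \<phi> i v"
  shows "endo_trace smul V T = (\<Sum>i\<in>I. \<phi> i (T (e i)))"
proof -
  interpret vector_space smul by fact
  have T_sum: "T (\<Sum>i\<in>J. smul (c i) (f i)) = (\<Sum>i\<in>J. smul (c i) (T (f i)))"
    if "finite J" "\<And>i. i \<in> J \<Longrightarrow> f i \<in> V" for c J and f :: "'j \<Rightarrow> 'v"
    using that
  proof (induction J rule: finite_induct)
    case empty
    have "T (smul 0 0) = smul 0 (T 0)" using V by (intro T_scale) (simp add: subspace_0)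
    then show ?case by simp
  next
    case (insert j J)
    then show ?case
      using V by (simp add: T_add T_scale subspace_sum subspace_scale)
  qed
  have \<phi>_sum: "\<phi> i (\<Sum>j\<in>J. smul (c j) (f j)) = (\<Sum>j\<in>J. c j * \<phi> i (f j))"
    if "finite J" "i \<in> I" "\<And>j. j \<in> J \<Longrightarrow> f j \<in> V" for c J i and f :: "'j \<Rightarrow> 'v"
    using that
  proof (induction J rule: finite_induct)
    case empty
    have "\<phi> i (smul 0 0) = 0 * \<phi> i 0" using V empty by (intro \<phi>_scale) (simp_all add: subspace_0)
    then show ?case by simp
  next
    case (insert j J)
    then show ?case
      using V by (simp add: \<phi>_add \<phi>_scale subspace_sum subspace_scale)
  qed
  define B where "B = (SOME B. \<not> module.dependent smul B \<and> module.span smul B = V)"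
  obtain B' where "B' \<subseteq> V" "independent B'" "V \<subseteq> span B'"
    using maximal_independent_subset .
  then have "\<not> dependent B' \<and> span B' = V"
    using V span_minimal by (metis subset_antisym)
  then have B: "independent B" "span B = V"
    unfolding B_def by (metis (mono_tags, lifting) someI_ex)+
  have "V \<subseteq> span (e ` I)"
  proof
    fix v assume "v \<in> V"
    then show "v \<in> span (e ` I)"
      by (subst resolution) (auto intro!: span_sum span_scale intro: span_base)
  qed
  moreover have "B \<subseteq> V" using B span_superset by auto
  ultimately have finB: "finite B"
    using independent_span_bound[OF finite_imageI[OF I] B(1)] by blast
  have exp: "v = (\<Sum>b\<in>B. smul (representation B v b) b)" if "v \<in> V" for v
    using sum_representation_eq[OF B(1) _ finB subset_refl, of v] that B(2) by simp
  have "endo_trace smul V T = (\<Sum>b\<in>B. representation B (T b) b)"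
    by (simp add: endo_trace_def B_def Let_def)
  also have "\<dots> = (\<Sum>b\<in>B. \<Sum>i\<in>I. \<phi> i b * representation B (T (e i)) b)"
  proof (rule sum.cong[OF refl])
    fix b assume b: "b \<in> B"
    then have bV: "b \<in> V" using \<open>B \<subseteq> V\<close> by auto
    have "T b = (\<Sum>i\<in>I. smul (\<phi> i b) (T (e i)))"
      by (subst resolution[OF bV]) (rule T_sum[OF I e])
    then have "representation B (T b) = (\<lambda>x. \<Sum>i\<in>I. representation B (smul (\<phi> i b) (T (e i))) x)"
      using e T by (simp add: representation_sum[OF B(1)] span_scale B(2) V subspace_scale)
    then show "representation B (T b) b = (\<Sum>i\<in>I. \<phi> i b * representation B (T (e i)) b)"
      using e T by (simp add: representation_scale[OF B(1)] B(2))
  qed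
  also have "\<dots> = (\<Sum>i\<in>I. \<Sum>b\<in>B. representation B (T (e i)) b * \<phi> i b)"
    by (subst sum.swap) (simp add: mult.commute)
  also have "\<dots> = (\<Sum>i\<in>I. \<phi> i (T (e i)))"
  proof (rule sum.cong[OF refl])
    fix i assume i: "i \<in> I"
    show "(\<Sum>b\<in>B. representation B (T (e i)) b * \<phi> i b) = \<phi> i (T (e i))"
      using \<open>B \<subseteq> V\<close> by (subst (2) exp[OF T[OF e[OF i]]], subst \<phi>_sum[OF finB i]) auto
  qed
  finally show ?thesis .
qed

lemma vector_space_pointwise:
  assumes "vector_space smul"
  shows "vector_space (\<lambda>c (f :: 'a \<Rightarrow> 'v::ab_group_add) x. smul c (f x))"
proof -
  interpret vector_space smul by fact
  show ?thesis
    by unfold_locales (auto simp: fun_eq_iff scale_right_distrib scale_left_distrib)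
qed

lemma sum_fun_nth: "(\<Sum>i\<in>I. f i) x = (\<Sum>i\<in>I. f i x)" for f :: "'i \<Rightarrow> 'a \<Rightarrow> 'v::ab_group_add"
  by (induction I rule: infinite_finite_induct) auto

text \<open>A representation with a chosen basis, in which traces are computed. A
  basis of the space is fixed because \<open>unitary_rep\<close> only provides a finite spanning set.\<close>

locale based_rep =
  fixes G :: "cmat2 set" and \<rho> :: "'v::ab_group_add crep" and B :: "'v set"
  assumes subgroup: "subgroup G SL2C"
    and vs: "vector_space (rep_scale \<rho>)"
    and finite_basis: "finite B"
    and indep: "\<not> module.dependent (rep_scale \<rho>) B"
    and span_basis: "module.span (rep_scale \<rho>) B = rep_space \<rho>"
    and act_closed: "g \<in> G \<Longrightarrow> v \<in> rep_space \<rho> \<Longrightarrow> rep_act \<rho> g v \<in> rep_space \<rho>"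
    and act_add: "g \<in> G \<Longrightarrow> u \<in> rep_space \<rho> \<Longrightarrow> v \<in> rep_space \<rho> \<Longrightarrow>
                  rep_act \<rho> g (u + v) = rep_act \<rho> g u + rep_act \<rho> g v"
    and act_scale: "g \<in> G \<Longrightarrow> v \<in> rep_space \<rho> \<Longrightarrow>
                  rep_act \<rho> g (rep_scale \<rho> c v) = rep_scale \<rho> c (rep_act \<rho> g v)"
    and act_one: "v \<in> rep_space \<rho> \<Longrightarrow> rep_act \<rho> (mat 1) v = v"
    and act_mult: "g \<in> G \<Longrightarrow> h \<in> G \<Longrightarrow> v \<in> rep_space \<rho> \<Longrightarrow>
                  rep_act \<rho> (g ** h) v = rep_act \<rho> g (rep_act \<rho> h v)"

lemma unitary_rep_based:
  assumes "subgroup G SL2C" and \<rho>: "unitary_rep G \<rho>"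
  obtains B where "based_rep G \<rho> B"
proof -
  from \<rho> have vs: "vector_space (rep_scale \<rho>)" by (simp add: unitary_rep_def Let_def)
  then interpret vector_space "rep_scale \<rho>" .
  obtain B0 where B0: "finite B0" "span B0 = rep_space \<rho>"
    using \<rho> by (auto simp: unitary_rep_def Let_def)
  obtain B where B: "B \<subseteq> rep_space \<rho>" "independent B" "rep_space \<rho> \<subseteq> span B"
    using maximal_independent_subset .
  have "span B = rep_space \<rho>"
    using B B0 span_minimal[OF _ subspace_span] by (metis subset_antisym)
  moreover have "finite B" using independent_span_bound[OF B0(1) B(2)] B B0 by simp
  ultimately have "based_rep G \<rho> B"
    using assms B(2) by (intro based_rep.intro) (simp_all add: unitary_rep_def Let_def)
  then show ?thesis by (rule that)
qed

context based_rep
begin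

sublocale vector_space "rep_scale \<rho>" by (rule vs)

abbreviation V where "V \<equiv> rep_space \<rho>"
abbreviation act where "act \<equiv> rep_act \<rho>"
abbreviation smul where "smul \<equiv> rep_scale \<rho>"
abbreviation coeff where "coeff b v \<equiv> representation B v b"

lemma subspace_V: "subspace V"
  unfolding span_basis[symmetric] by (rule subspace_span)

lemma basis_subset: "b \<in> B \<Longrightarrow> b \<in> V"
  unfolding span_basis[symmetric] by (rule span_base)

lemma expansion: "v \<in> V \<Longrightarrow> v = (\<Sum>b\<in>B. smul (coeff b v) b)"
  using sum_representation_eq[OF indep _ finite_basis subset_refl, of v] span_basis by simp

lemma coeff_add: "u \<in> V \<Longrightarrow> v \<in> V \<Longrightarrow> coeff b (u + v) = coeff b u + coeff b v"
  by (simp add: representation_add[OF indep] span_basis)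

lemma coeff_scale: "v \<in> V \<Longrightarrow> coeff b (smul c v) = c * coeff b v"
  by (simp add: representation_scale[OF indep] span_basis)

lemma act_expansion:
  assumes g: "g \<in> G" and v: "v \<in> V"
  shows "act g v = (\<Sum>b\<in>B. smul (coeff b v) (act g b))"
proof -
  have "act g (\<Sum>b\<in>J. smul (c b) b) = (\<Sum>b\<in>J. smul (c b) (act g b))" if "finite J" "J \<subseteq> B" for c J
    using that
  proof (induction J rule: finite_induct)
    case empty
    have "act g (smul 0 0) = smul 0 (act g 0)"
      using g subspace_V by (intro act_scale) (auto simp: subspace_0)
    then show ?case by simp
  next
    case (insert b J)
    have "(\<Sum>b\<in>J. smul (c b) b) \<in> V" "b \<in> V"
      using insert basis_subset subspace_V by (auto intro!: subspace_sum subspace_scale)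
    then show ?case
      using insert g subspace_V by (simp add: act_add act_scale subspace_scale)
  qed
  from this[OF finite_basis subset_refl] show ?thesis
    by (subst expansion[OF v])
qed

lemma rep_trace_eq_sum:
  assumes g: "g \<in> G"
  shows "rep_trace \<rho> g = (\<Sum>b\<in>B. coeff b (act g b))"
  unfolding rep_trace_def
  by (rule endo_trace_eq_sum[where e = "\<lambda>b. b", OF vs subspace_V finite_basis])
    (use g in \<open>auto intro: basis_subset expansion act_closed act_add act_scale coeff_add coeff_scale\<close>)

lemma act_inv_cancel:
  assumes "g \<in> G" "v \<in> V"
  shows "act g (act (inv\<^bsub>SL2C\<^esub> g) v) = v"
  using assms subgroup_SL2C[OF subgroup]
  by (simp flip: act_mult add: SL2C_inv act_one)

text \<open>The trace of \<open>h g h\<inverse>\<close> in the basis \<open>h B\<close> is the trace of \<open>g\<close> in the basis \<open>B\<close>.\<close>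

lemma rep_trace_conj:
  assumes g: "g \<in> G" and h: "h \<in> G"
  shows "rep_trace \<rho> (h ** g ** inv\<^bsub>SL2C\<^esub> h) = rep_trace \<rho> g"
proof -
  note G = subgroup_SL2C[OF subgroup]
  have hi: "inv\<^bsub>SL2C\<^esub> h \<in> G" and c: "h ** g ** inv\<^bsub>SL2C\<^esub> h \<in> G" using g h G by auto
  have "rep_trace \<rho> (h ** g ** inv\<^bsub>SL2C\<^esub> h) =
      (\<Sum>b\<in>B. coeff b (act (inv\<^bsub>SL2C\<^esub> h) (act (h ** g ** inv\<^bsub>SL2C\<^esub> h) (act h b))))"
    unfolding rep_trace_def
  proof (rule endo_trace_eq_sum[where e = "act h", OF vs subspace_V finite_basis])
    fix v assume v: "v \<in> V"
    show "v = (\<Sum>b\<in>B. smul (coeff b (act (inv\<^bsub>SL2C\<^esub> h) v)) (act h b))"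
      using act_expansion[OF h act_closed[OF hi v]] by (simp add: act_inv_cancel h v)
  qed (use h hi c in \<open>auto intro: basis_subset act_closed simp: act_add act_scale coeff_add coeff_scale act_closed\<close>)
  also have "\<dots> = (\<Sum>b\<in>B. coeff b (act g b))"
  proof (rule sum.cong[OF refl])
    fix b assume "b \<in> B"
    then have b: "b \<in> V" by (rule basis_subset)
    have "act (inv\<^bsub>SL2C\<^esub> h) (act (h ** g ** inv\<^bsub>SL2C\<^esub> h) (act h b)) =
        act (inv\<^bsub>SL2C\<^esub> h ** (h ** g ** inv\<^bsub>SL2C\<^esub> h ** h)) b"
      using h hi c b G(3) by (simp add: act_mult act_closed)
    also have "inv\<^bsub>SL2C\<^esub> h ** (h ** g ** inv\<^bsub>SL2C\<^esub> h ** h) = g"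
      by (simp add: SL2C_inv_cancel[OF G(1)[OF h]])
    finally show "coeff b (act (inv\<^bsub>SL2C\<^esub> h) (act (h ** g ** inv\<^bsub>SL2C\<^esub> h) (act h b))) = coeff b (act g b)"
      by simp
  qed
  finally show ?thesis by (simp add: rep_trace_eq_sum g)
qed

text \<open>Frobenius' formula for the character of an induced representation. For a coset \<open>C\<close> with representative
  \<open>x C\<close> and a basis vector \<open>b\<close>, let \<open>e (C, b)\<close> be the function in the induced space that is
  supported on \<open>C\<close> and has value \<open>b\<close> at \<open>x C\<close>. These functions form a basis, whose coordinate functionals
  are the coordinates of the value at \<open>x C\<close>. Right translation by \<open>P\<close> has a nonzero
  diagonal block at \<open>C\<close> only if \<open>x C ** P\<close> lies in \<open>C\<close>, that is, if \<open>x C\<close> conjugates \<open>P\<close> into \<open>G\<close>;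
  the block is then the action of the conjugate.\<close>

lemma rep_trace_induced:
  assumes G': "subgroup G' SL2C" and sub: "G \<subseteq> G'" and fin: "finite (right_cosets G G')"
    and x: "\<And>C. C \<in> right_cosets G G' \<Longrightarrow> x C \<in> C" and P: "P \<in> G'"
  shows "rep_trace (induced_rep G G' \<rho>) P =
           (\<Sum>C | C \<in> right_cosets G G' \<and> x C ** P ** inv\<^bsub>SL2C\<^esub> (x C) \<in> G.
              rep_trace \<rho> (x C ** P ** inv\<^bsub>SL2C\<^esub> (x C)))"
proof -
  note g = subgroup_SL2C[OF subgroup] and g' = subgroup_SL2C[OF G']
  let ?R = "right_cosets G G'" and ?inv = "\<lambda>y. inv\<^bsub>SL2C\<^esub> y"
  let ?V' = "rep_space (induced_rep G G' \<rho>)"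
  have V': "f \<in> ?V' \<longleftrightarrow> (\<forall>y. y \<notin> G' \<longrightarrow> f y = 0) \<and> (\<forall>y\<in>G'. f y \<in> V) \<and>
      (\<forall>h\<in>G. \<forall>y\<in>G'. f (h ** y) = act h (f y))" for f
    by (simp add: induced_rep_def)
  have xG': "x C \<in> G'" if "C \<in> ?R" for C
    using x[OF that] that sub g' by (auto simp: right_cosets_eq rcos_def)
  have C_eq: "C = rcos G (x C)" if C: "C \<in> ?R" for C
  proof -
    obtain y where y: "y \<in> G'" "C = rcos G y" using C by (auto simp: right_cosets_eq)
    then have "x C ** ?inv y \<in> G" using x[OF C] mem_rcos_iff[OF subgroup g'(1)] by simp
    then show ?thesis using y rcos_eq_iff[OF subgroup] g'(1) xG'[OF C] by metis
  qed
  have mem_C: "y \<in> C \<longleftrightarrow> y ** ?inv (x C) \<in> G" if "C \<in> ?R" for C y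
    using C_eq[OF that] mem_rcos_iff[OF subgroup g'(1)[OF xG'[OF that]]] by simp
  have C_sub: "y \<in> G'" if "C \<in> ?R" "y \<in> C" for C y
    using that sub g' by (auto simp: right_cosets_eq rcos_def)
  have mem_eq: "C = rcos G y" if C: "C \<in> ?R" and y: "y \<in> C" for C y
    using C_eq[OF C] mem_C[OF C] y rcos_eq_iff[OF subgroup g'(1)[OF C_sub[OF C y]] g'(1)[OF xG'[OF C]]]
    by simp
  define e where "e = (\<lambda>(C, b) y. if y \<in> C then act (y ** ?inv (x C)) b else 0)"
  define \<phi> where "\<phi> = (\<lambda>(C, b) f. coeff b (f (x C)))"
  let ?I = "?R \<times> B"
  interpret W: vector_space "\<lambda>c (f :: cmat2 \<Rightarrow> 'v) y. smul c (f y)"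
    by (rule vector_space_pointwise[OF vs])
  have "rep_trace (induced_rep G G' \<rho>) P = endo_trace (\<lambda>c f y. smul c (f y)) ?V' (\<lambda>f y. f (y ** P))"
    by (simp add: rep_trace_def induced_rep_def)
  also have "\<dots> = (\<Sum>i\<in>?I. \<phi> i (\<lambda>y. e i (y ** P)))"
  proof (rule endo_trace_eq_sum)
    show "vector_space (\<lambda>c (f :: cmat2 \<Rightarrow> 'v) y. smul c (f y))" by unfold_locales
    show "W.subspace ?V'"
    proof (rule W.subspaceI)
      have "act h 0 = 0" if "h \<in> G" for h
        using act_scale[OF that, of 0 0] subspace_V by (simp add: subspace_0)
      then show "0 \<in> ?V'" using subspace_V by (simp add: V' subspace_0)
    qed (use subspace_V in \<open>auto simp: V' subspace_add subspace_scale act_add act_scale\<close>)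
    show "finite ?I" using fin finite_basis by simp
    show "e i \<in> ?V'" if i_in: "i \<in> ?I" for i
    proof -
      obtain C b where i: "i = (C, b)" and C: "C \<in> ?R" and b: "b \<in> V" using i_in basis_subset by auto
      have "e i (h ** y) = act h (e i y)" if h: "h \<in> G" and y: "y \<in> G'" for h y
      proof -
        have "y ** ?inv (x C) = ?inv h ** (h ** y ** ?inv (x C))"
          using SL2C_inv_cancel[OF g(1)[OF h]] by (simp flip: matrix_mul_assoc)
        then have "h ** y \<in> C \<longleftrightarrow> y \<in> C"
          unfolding mem_C[OF C] using g h by (metis matrix_mul_assoc)
        moreover have "act h 0 = 0"
          using act_scale[OF h, of 0 0] subspace_V by (simp add: subspace_0)
        ultimately show ?thesis
          using h b mem_C[OF C] by (auto simp: e_def i act_mult simp flip: matrix_mul_assoc)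
      qed
      then show ?thesis
        using C b C_sub[OF C] mem_C[OF C] subspace_V
        by (auto simp: V' e_def i subspace_0 intro: act_closed)
    qed
    show "f = (\<Sum>i\<in>?I. (\<lambda>y. smul (\<phi> i f) (e i y)))" if f: "f \<in> ?V'" for f
    proof
      fix y
      have "(\<Sum>i\<in>?I. (\<lambda>y. smul (\<phi> i f) (e i y))) y =
          (\<Sum>C\<in>?R. \<Sum>b\<in>B. smul (coeff b (f (x C))) (e (C, b) y))"
        by (simp add: sum_fun_nth sum.cartesian_product \<phi>_def case_prod_unfold)
      also have "\<dots> = f y"
      proof (cases "y \<in> G'")
        case False
        then have "y \<notin> C" if "C \<in> ?R" for C using C_sub that by blast
        then show ?thesis using False f by (simp add: e_def V')
      next
        case y: True
        let ?C = "rcos G y"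
        have C: "?C \<in> ?R" "y \<in> ?C" using y rcos_self[OF subgroup] by (auto simp: right_cosets_eq)
        have "e (C, b) y = 0" if "C \<in> ?R" "C \<noteq> ?C" for C b
        proof -
          have "y \<notin> C" using mem_eq that by blast
          then show ?thesis by (simp add: e_def)
        qed
        then have "(\<Sum>C\<in>?R. \<Sum>b\<in>B. smul (coeff b (f (x C))) (e (C, b) y)) =
            (\<Sum>C\<in>{?C}. \<Sum>b\<in>B. smul (coeff b (f (x C))) (e (C, b) y))"
          using C(1) by (intro sum.mono_neutral_right fin ballI sum.neutral) auto
        also have "\<dots> = (\<Sum>b\<in>B. smul (coeff b (f (x ?C))) (act (y ** ?inv (x ?C)) b))"
          using C by (simp add: e_def)
        also have "\<dots> = act (y ** ?inv (x ?C)) (f (x ?C))"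
          using mem_C[OF C(1)] C(2) f xG'[OF C(1)] by (intro act_expansion[symmetric]) (auto simp: V')
        also have "\<dots> = f (y ** ?inv (x ?C) ** x ?C)"
          using mem_C[OF C(1)] C(2) f xG'[OF C(1)] by (simp add: V')
        also have "\<dots> = f y" by (simp add: SL2C_inv_cancel[OF g'(1)[OF xG'[OF C(1)]]])
        finally show ?thesis .
      qed
      finally show "f y = (\<Sum>i\<in>?I. (\<lambda>y. smul (\<phi> i f) (e i y))) y" ..
    qed
    show "(\<lambda>y. f (y ** P)) \<in> ?V'" if f: "f \<in> ?V'" for f
    proof -
      have "y ** P \<in> G' \<longleftrightarrow> y \<in> G'" for y
        using g'(3,4) P SL2C_inv_cancel(3)[OF g'(1)[OF P], of y] by metis
      then show ?thesis using f by (auto simp: V' simp flip: matrix_mul_assoc)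
    qed
  qed (auto simp: \<phi>_def V' xG' coeff_add coeff_scale)
  also have "\<dots> = (\<Sum>C\<in>?R. \<Sum>b\<in>B. coeff b (e (C, b) (x C ** P)))"
    by (simp add: sum.cartesian_product \<phi>_def case_prod_unfold)
  also have "\<dots> = (\<Sum>C\<in>?R. if x C ** P ** ?inv (x C) \<in> G then rep_trace \<rho> (x C ** P ** ?inv (x C)) else 0)"
    by (intro sum.cong refl) (auto simp: e_def mem_C rep_trace_eq_sum representation_zero)
  also have "\<dots> = (\<Sum>C | C \<in> ?R \<and> x C ** P ** ?inv (x C) \<in> G. rep_trace \<rho> (x C ** P ** ?inv (x C)))"
    using fin by (simp add: sum.inter_filter)
  finally show ?thesis .
qed

end

section \<open>Comparison of the two series\<close>

lemma hyperbolic_conj: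
  assumes "det h = 1"
  shows "hyperbolic (h ** P ** inv\<^bsub>SL2C\<^esub> h) \<longleftrightarrow> hyperbolic P"
  by (simp add: hyperbolic_def trace_conj[OF assms])

lemma diag_conj_conj:
  assumes "det y = 1" "det S = 1"
  shows "y ** diag_conj S c ** inv\<^bsub>SL2C\<^esub> y = diag_conj (y ** S) c"
  by (simp add: diag_conj_def SL2C_inv_mult assms matrix_mul_assoc)

lemma big_eigenvalue_conj:
  assumes y: "det y = 1" and P: "det P = 1" "hyperbolic P"
  shows "big_eigenvalue (y ** P ** inv\<^bsub>SL2C\<^esub> y) = big_eigenvalue P"
proof -
  obtain S a where "det S = 1" "cmod a > 1" "P = diag_conj S a"
    using hyperbolic_diagonalizable[OF P(2,1)] .
  then show ?thesis by (simp add: diag_conj_conj y big_eigenvalue_diag_conj det_mul)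
qed

text \<open>The cosets \<open>G x\<close> that conjugate \<open>P\<close> into the class of \<open>Q = y P y\<inverse>\<close> are those of the form
  \<open>G w y\<close> with \<open>w\<close> in the centralizer of \<open>Q\<close> in \<open>G'\<close>, and \<open>G w y\<close> depends only on the coset of \<open>w\<close>
  modulo the centralizer of \<open>Q\<close> in \<open>G\<close>. With \<open>w\<close> running through the matrices
  \<open>diag_conj S1 u\<close>, this is the situation of \<open>dilation_group_index\<close>.\<close>

lemma card_cosets_over_class:
  assumes G: "subgroup G SL2C" and G': "subgroup G' SL2C" and sub: "G \<subseteq> G'"
    and disc: "discrete G'" and P: "P \<in> G'" "hyperbolic P"
    and y: "y \<in> G'" and Q: "Q = y ** P ** inv\<^bsub>SL2C\<^esub> y" "Q \<in> G"
    and x: "\<And>C. C \<in> right_cosets G G' \<Longrightarrow> x C \<in> C"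
  shows
    "real (card {C \<in> right_cosets G G'. x C ** P ** inv\<^bsub>SL2C\<^esub> (x C) \<in> conj_class G Q}) *
           (ln (primitive_norm G' P) / real (card (centralizer_tor G' P))) =
         ln (primitive_norm G Q) / real (card (centralizer_tor G Q))"
proof -
  note g = subgroup_SL2C[OF G] and g' = subgroup_SL2C[OF G']
  let ?inv = "\<lambda>y. inv\<^bsub>SL2C\<^esub> y"
  obtain S a where Sa: "det S = 1" "cmod a > 1" "P = diag_conj S a"
    using hyperbolic_diagonalizable[OF P(2) g'(1)[OF P(1)]] .
  have dy: "det y = 1" using g'(1)[OF y] .
  define S1 where "S1 = y ** S"
  have S1: "det S1 = 1" by (simp add: S1_def det_mul dy Sa)
  have conj_S1: "y ** diag_conj S c ** ?inv y = diag_conj S1 c" for c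
    using diag_conj_conj[OF dy Sa(1)] by (simp add: S1_def)
  have Q_eq: "Q = diag_conj S1 a" by (simp add: Q Sa(3) conj_S1)
  have "discrete G" using disc sub by (rule discrete_subset)
  interpret T: hyperbolic_torus G S1 a
    using G \<open>discrete G\<close> S1 Sa Q Q_eq by (intro hyperbolic_torus.intro) auto
  interpret T': hyperbolic_torus G' S a
    using G' disc P Sa by (intro hyperbolic_torus.intro) auto
  obtain c where c: "T.least_dilation c" using T.least_dilation_exists .
  obtain c' where c': "T'.least_dilation c'" using T'.least_dilation_exists .
  \<comment> \<open>As \<open>y \<in> G'\<close>, the centralizers of \<open>P\<close> and \<open>Q\<close> in \<open>G'\<close> have the same parameters.\<close>
  have params: "diag_params G' S = diag_params G' S1"
  proof -
    have "diag_conj S c \<in> G' \<longleftrightarrow> y ** diag_conj S c ** ?inv y \<in> G'" for c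
    proof
      assume "y ** diag_conj S c ** ?inv y \<in> G'"
      then have "?inv y ** (y ** diag_conj S c ** ?inv y) ** y \<in> G'"
        using g'(3)[OF g'(3)[OF g'(4)[OF y]] y] by blast
      then show "diag_conj S c \<in> G'" by (simp add: matrix_mul_assoc SL2C_inv[OF dy] SL2C_inv_cancel[OF dy])
    qed (use g'(3)[OF g'(3)[OF y] g'(4)[OF y]] in blast)
    then show ?thesis by (simp add: diag_params_def conj_S1)
  qed
  define \<phi> where "\<phi> = (\<lambda>c. rcos G (diag_conj S1 c ** y))"
  have \<phi>_eq_iff: "\<phi> u = \<phi> v \<longleftrightarrow> u / v \<in> diag_params G S1"
    if "u \<in> diag_params G' S" "v \<in> diag_params G' S" for u v
  proof -
    have nz: "u \<noteq> 0" "v \<noteq> 0" using that by (auto simp: diag_params_def)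
    have d: "det (diag_conj S1 u) = 1" "det (diag_conj S1 v) = 1" using nz S1 by (simp_all add: det_diag_conj)
    have "diag_conj S1 u ** y ** ?inv (diag_conj S1 v ** y) = diag_conj S1 (u / v)"
      by (simp add: SL2C_inv_mult d dy matrix_mul_assoc SL2C_inv_cancel[OF dy] divide_inverse
          diag_conj_mult[OF S1] diag_conj_inverse[OF S1 nz(2)])
    then show ?thesis
      using nz by (simp add: \<phi>_def rcos_eq_iff[OF G] det_mul d dy diag_params_def)
  qed
  have index: "real (card (\<phi> ` diag_params G' S)) * (ln (cmod c') / real (card T'.unit_part)) =
      ln (cmod c) / real (card T.unit_part)"
    by (rule dilation_group_index[OF T.discrete_dilation_group_axioms T'.discrete_dilation_group_axioms _ c c' \<phi>_eq_iff])
      (use sub params in \<open>auto simp: diag_params_def\<close>)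
  have "\<phi> ` diag_params G' S = {C \<in> right_cosets G G'. x C ** P ** ?inv (x C) \<in> conj_class G Q}"
    (is "_ = ?X")
  proof (intro equalityI subsetI)
    fix C assume "C \<in> \<phi> ` diag_params G' S"
    then obtain u where u: "u \<noteq> 0" "diag_conj S1 u \<in> G'" "C = \<phi> u"
      unfolding params by (auto simp: diag_params_def)
    have C: "C \<in> right_cosets G G'" using u y g' by (auto simp: \<phi>_def right_cosets_eq)
    then obtain h where h: "h \<in> G" "x C = h ** (diag_conj S1 u ** y)"
      using x[OF C] u by (auto simp: \<phi>_def rcos_def)
    have comm: "diag_conj S1 u ** Q ** ?inv (diag_conj S1 u) = Q"
    proof -
      have "diag_conj S1 u ** Q = Q ** diag_conj S1 u"
        unfolding Q_eq by (simp add: mult.commute flip: diag_conj_mult[OF S1])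
      then show ?thesis by (simp add: SL2C_inv_cancel det_diag_conj S1 u)
    qed
    have "x C ** P ** ?inv (x C) = h ** (diag_conj S1 u ** Q ** ?inv (diag_conj S1 u)) ** ?inv h"
      using g(1)[OF h(1)] dy
      by (simp add: h(2) Q(1) conj_conj det_mul det_diag_conj S1 u(1))
    then show "C \<in> ?X" using C h by (auto simp: comm conj_class_def)
  next
    fix C assume "C \<in> ?X"
    then have C: "C \<in> right_cosets G G'" and cl: "x C ** P ** ?inv (x C) \<in> conj_class G Q" by auto
    obtain h where h: "h \<in> G" "x C ** P ** ?inv (x C) = h ** Q ** ?inv h"
      using cl by (auto simp: conj_class_def)
    obtain z where z: "z \<in> G'" "C = rcos G z" using C by (auto simp: right_cosets_eq)
    have xz: "x C ** ?inv z \<in> G" using x[OF C] z by (simp add: mem_rcos_iff[OF G g'(1)])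
    then have xG': "x C \<in> G'"
      using g'(3)[of "x C ** ?inv z" z] z(1) sub SL2C_inv_cancel(4)[OF g'(1)[OF z(1)]] by auto
    have dx: "det (x C) = 1" and dh: "det h = 1" using g'(1)[OF xG'] g(1)[OF h(1)] .
    \<comment> \<open>By the choice of \<open>h\<close>, the element \<open>w\<close> centralizes \<open>Q\<close>, and \<open>x C = h w y\<close>.\<close>
    define w where "w = ?inv h ** x C ** ?inv y"
    have wG': "w \<in> G'" 
    unfolding w_def using h(1) sub by (intro g'(3,4) xG' y) auto
    have dw: "det w = 1" using g'(1)[OF wG'] .
    have hwy: "h ** w ** y = x C"
      by (simp add: w_def matrix_mul_assoc SL2C_inv[OF dh] SL2C_inv_cancel[OF dy])
    have "w ** Q ** ?inv w = ?inv h ** (x C ** P ** ?inv (x C)) ** ?inv (?inv h)"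
      unfolding Q(1) conj_conj[OF dw dy] conj_conj[OF SL2C_inv(1)[OF dh] dx]
      by (simp add: w_def SL2C_inv_cancel[OF dy])
    also have "\<dots> = Q"
      by (simp add: h(2) SL2C_inv_inv dh matrix_mul_assoc SL2C_inv SL2C_inv_cancel[OF dh])
    finally have "w ** Q = Q ** w" by (metis SL2C_inv_cancel(4)[OF dw])
    then obtain u where u: "u \<noteq> 0" "w = diag_conj S1 u"
      using commute_diag_conj_iff[OF S1 Sa(2) dw] Q_eq by auto
    have "x C ** ?inv (w ** y) \<in> G"
      using h(1) by (simp flip: hwy add: SL2C_inv_mult dw dy matrix_mul_assoc SL2C_inv_cancel)
    then have "rcos G (w ** y) = rcos G (x C)"
      using rcos_eq_iff[OF G dx, of "w ** y"] dw dy by (simp add: det_mul)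
    also have "\<dots> = C" using xz rcos_eq_iff[OF G dx g'(1)[OF z(1)]] z by simp
    finally have "C = \<phi> u" by (simp add: \<phi>_def u)
    moreover have "u \<in> diag_params G' S" unfolding params using u wG' by (simp add: diag_params_def)
    ultimately show "C \<in> \<phi> ` diag_params G' S" by blast
  qed
  moreover have "ln (primitive_norm G' P) = 2 * ln (cmod c')"
    using T'.primitive_norm_eq[OF c'] c' by (simp add: Sa(3) T'.least_dilation_def ln_realpow)
  moreover have "ln (primitive_norm G Q) = 2 * ln (cmod c)"
    using T.primitive_norm_eq[OF c] c by (simp add: Q_eq T.least_dilation_def ln_realpow)
  moreover have "card (centralizer_tor G' P) = card T'.unit_part"
    using T'.card_centralizer_tor by (simp add: Sa(3))
  moreover have "card (centralizer_tor G Q) = card T.unit_part"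
    using T.card_centralizer_tor by (simp add: Q_eq)
  ultimately show "real (card ?X) * (ln (primitive_norm G' P) / real (card (centralizer_tor G' P))) =
         ln (primitive_norm G Q) / real (card (centralizer_tor G Q))"
    using arg_cong[OF index, of "\<lambda>t. 2 * t"] by (simp add: mult.left_commute)
qed

text \<open>The set \<open>\<D>\<close> consists of the \<open>G\<close>-classes inside the \<open>G'\<close>-class of \<open>P\<close>. The sum in Frobenius' formula
  is arranged by these classes; on each of them the trace is constant, and the number of cosets
  converts the weight of \<open>P\<close> in \<open>G'\<close> into the weight of the class in \<open>G\<close>.\<close>

lemma z_term_induced:
  assumes G: "subgroup G SL2C" and G': "subgroup G' SL2C" and sub: "G \<subseteq> G'"
    and disc: "discrete G'" and fin: "finite (right_cosets G G')" and \<rho>: "unitary_rep G \<rho>"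
    and P: "P \<in> G'" "hyperbolic P"
  defines "\<D> \<equiv> conj_class G ` (conj_class G' P \<inter> G)"
  shows "finite \<D>"
    and "z_term G' (induced_rep G G' \<rho>) s P = (\<Sum>D\<in>\<D>. z_class_term G \<rho> s D)"
proof -
  note g = subgroup_SL2C[OF G] and g' = subgroup_SL2C[OF G']
  let ?inv = "\<lambda>y. inv\<^bsub>SL2C\<^esub> y" and ?R = "right_cosets G G'"
  obtain B where "based_rep G \<rho> B" using unitary_rep_based[OF G \<rho>] .
  then interpret based_rep G \<rho> B .
  define x where "x C = (SOME y. y \<in> C)" for C :: "cmat2 set"
  have x: "x C \<in> C" if "C \<in> ?R" for C
  proof -
    obtain y where "C = rcos G y" using \<open>C \<in> ?R\<close> by (auto simp: right_cosets_eq)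
    then show ?thesis unfolding x_def using rcos_self[OF G, of y] by (metis someI)
  qed
  have xG': "x C \<in> G'" if "C \<in> ?R" for C
    using x[OF that] that sub g' by (auto simp: right_cosets_eq rcos_def)
  define Q where "Q C = x C ** P ** ?inv (x C)" for C
  define X where "X = {C \<in> ?R. Q C \<in> G}"
  have finX: "finite X" using fin by (simp add: X_def)
  have \<D>: "(\<lambda>C. conj_class G (Q C)) ` X = \<D>"
  proof (intro equalityI subsetI)
    fix D assume "D \<in> \<D>"
    then obtain y where y: "y \<in> G'" "y ** P ** ?inv y \<in> G" "D = conj_class G (y ** P ** ?inv y)"
      by (auto simp: \<D>_def conj_class_def)
    let ?C = "rcos G y"
    have C: "?C \<in> ?R" using y by (auto simp: right_cosets_eq)
    then obtain h where h: "h \<in> G" "x ?C = h ** y" using x[OF C] by (auto simp: rcos_def)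
    have "Q ?C = h ** (y ** P ** ?inv y) ** ?inv h"
      using conj_conj[OF g(1)[OF h(1)] g'(1)[OF y(1)]] by (simp add: Q_def h)
    moreover from this have "Q ?C \<in> G" using g h y by simp
    ultimately show "D \<in> (\<lambda>C. conj_class G (Q C)) ` X"
      using C y(3) conj_class_conj[OF G h(1)] by (intro image_eqI[of _ _ ?C]) (auto simp: X_def)
  qed (auto simp: \<D>_def X_def Q_def conj_class_def intro!: imageI xG')
  show "finite \<D>" using finX by (simp flip: \<D>)
  let ?a = "big_eigenvalue P"
  define E where "E = complex_of_real ((cmod (?a - inverse ?a))\<^sup>2)"
  define w' where "w' = ln (primitive_norm G' P) / real (card (centralizer_tor G' P))"
  define F where "F = complex_of_real (hyp_norm P) powr (- s)"
  have z_eq: "z_class_term G \<rho> s D = (\<Sum>C | C \<in> X \<and> conj_class G (Q C) = D. rep_trace \<rho> (Q C)) * of_real w' / E * F"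
    if D: "D \<in> \<D>" for D
  proof -
    obtain Q0 where Q0: "Q0 \<in> G" "Q0 \<in> conj_class G' P" "D = conj_class G Q0"
      using D by (auto simp: \<D>_def)
    define R where "R = (SOME P. P \<in> D)"
    have RD: "R \<in> D" unfolding R_def Q0(3) using mem_conj_class[OF G g(1)[OF Q0(1)]] by (rule someI)
    then obtain h where h: "h \<in> G" "R = h ** Q0 ** ?inv h" using Q0 by (auto simp: conj_class_def)
    have D_eq: "D = conj_class G R" using conj_class_conj[OF G h(1), of Q0] h(2) Q0(3) by simp
    obtain y where y: "y \<in> G'" "Q0 = y ** P ** ?inv y" using Q0 by (auto simp: conj_class_def)
    have hy: "h ** y \<in> G'" using g'(3)[OF _ y(1)] h(1) sub by blast
    have R: "R = (h ** y) ** P ** ?inv (h ** y)" "R \<in> G"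
      using conj_conj[OF g(1)[OF h(1)] g'(1)[OF y(1)]] h y g(3)[OF g(3)[OF h(1) Q0(1)] g(4)[OF h(1)]]
      by simp_all
    have card: "real (card {C \<in> ?R. Q C \<in> conj_class G R}) * w' =
        ln (primitive_norm G R) / real (card (centralizer_tor G R))"
      unfolding w'_def Q_def by (rule card_cosets_over_class[OF G G' sub disc P hy R]) (rule x)
    have big: "big_eigenvalue R = big_eigenvalue P"
      unfolding R(1) by (rule big_eigenvalue_conj[OF g'(1)[OF hy] g'(1)[OF P(1)] P(2)])
    have mem_iff: "C \<in> ?R \<and> Q C \<in> conj_class G R \<longleftrightarrow> C \<in> X \<and> conj_class G (Q C) = D" for C
    proof
      assume C: "C \<in> ?R \<and> Q C \<in> conj_class G R"
      then have "Q C \<in> G" using R g by (auto simp: conj_class_def)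
      then show "C \<in> X \<and> conj_class G (Q C) = D"
        using C conj_class_eqI[OF G, of "Q C" R] D_eq by (simp add: X_def)
    next
      assume C: "C \<in> X \<and> conj_class G (Q C) = D"
      then have "Q C \<in> conj_class G (Q C)" using mem_conj_class[OF G g(1)] unfolding X_def by blast
      then show "C \<in> ?R \<and> Q C \<in> conj_class G R" using C D_eq unfolding X_def by blast
    qed
    have tr: "rep_trace \<rho> (Q C) = rep_trace \<rho> R" if C: "C \<in> X \<and> conj_class G (Q C) = D" for C
    proof -
      obtain k where "k \<in> G" "Q C = k ** R ** ?inv k"
        using C mem_iff[of C] by (auto simp: conj_class_def)
      then show ?thesis using rep_trace_conj[OF R(2)] by simp
    qed
    have cd: "real (card {C. C \<in> X \<and> conj_class G (Q C) = D}) * w' =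
        ln (primitive_norm G R) / real (card (centralizer_tor G R))"
      using card by (simp only: mem_iff)
    have "(\<Sum>C | C \<in> X \<and> conj_class G (Q C) = D. rep_trace \<rho> (Q C)) * of_real w' / E * F =
        (\<Sum>C | C \<in> X \<and> conj_class G (Q C) = D. rep_trace \<rho> R) * of_real w' / E * F"
      by (simp add: tr)
    also have "\<dots> = rep_trace \<rho> R *
        of_real (real (card {C. C \<in> X \<and> conj_class G (Q C) = D}) * w') / E * F"
      by simp
    also have "\<dots> = z_term G \<rho> s R"
      unfolding cd by (simp add: z_term_def E_def F_def hyp_norm_def big)
    finally show ?thesis by (simp add: z_class_term_def R_def)
  qed
  have "rep_trace (induced_rep G G' \<rho>) P = (\<Sum>C\<in>X. rep_trace \<rho> (Q C))"
    using rep_trace_induced[OF G' sub fin x P(1)] by (simp add: X_def Q_def)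
  also have "\<dots> = (\<Sum>D\<in>\<D>. \<Sum>C | C \<in> X \<and> conj_class G (Q C) = D. rep_trace \<rho> (Q C))"
    unfolding \<D>[symmetric] by (rule sum.image_gen[OF finX])
  finally have tr: "rep_trace (induced_rep G G' \<rho>) P =
      (\<Sum>D\<in>\<D>. \<Sum>C | C \<in> X \<and> conj_class G (Q C) = D. rep_trace \<rho> (Q C))" .
  have "z_term G' (induced_rep G G' \<rho>) s P = rep_trace (induced_rep G G' \<rho>) P * of_real w' / E * F"
    by (simp add: z_term_def E_def F_def w'_def)
  also have "\<dots> = (\<Sum>D\<in>\<D>. z_class_term G \<rho> s D)"
    unfolding tr by (simp add: sum_distrib_right sum_divide_distrib z_eq)
  finally show "z_term G' (induced_rep G G' \<rho>) s P = (\<Sum>D\<in>\<D>. z_class_term G \<rho> s D)" .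
qed

text \<open>Every hyperbolic class of \<open>G\<close> lies in exactly one class of \<open>G'\<close>, so the series over \<open>G\<close> splits into
  the finite blocks \<open>\<D> C\<close>. A class of \<open>G'\<close> that misses \<open>G\<close> has an empty block and the term \<open>0\<close>.\<close>

lemma z_series_induced:
  assumes G: "subgroup G SL2C" and G': "subgroup G' SL2C" and sub: "G \<subseteq> G'"
    and disc: "discrete G'" and fin: "finite (right_cosets G G')" and \<rho>: "unitary_rep G \<rho>"
    and summable: "(\<lambda>C. norm (z_class_term G \<rho> s C)) summable_on hyperbolic_classes G"
  shows "(\<lambda>C. norm (z_class_term G' (induced_rep G G' \<rho>) s C)) summable_on hyperbolic_classes G'"
    and "z_series G' (induced_rep G G' \<rho>) s = z_series G \<rho> s"
proof -
  note g = subgroup_SL2C[OF G] and g' = subgroup_SL2C[OF G']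
  let ?A = "hyperbolic_classes G" and ?A' = "hyperbolic_classes G'"
  define \<D> where "\<D> C = {D \<in> ?A. D \<subseteq> C}" for C :: "cmat2 set"
  have "z_class_term G' (induced_rep G G' \<rho>) s C = (\<Sum>D\<in>\<D> C. z_class_term G \<rho> s D) \<and> finite (\<D> C)"
    if C: "C \<in> ?A'" for C
  proof -
    obtain P0 where P0: "P0 \<in> G'" "hyperbolic P0" "C = conj_class G' P0"
      using C by (auto simp: hyperbolic_classes_def)
    define P where "P = (SOME P. P \<in> C)"
    have "P \<in> C" unfolding P_def P0(3) using mem_conj_class[OF G' g'(1)[OF P0(1)]] by (rule someI)
    then obtain h where h: "h \<in> G'" "P = h ** P0 ** inv\<^bsub>SL2C\<^esub> h"
      using P0 by (auto simp: conj_class_def)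
    have P: "P \<in> G'" "hyperbolic P" "C = conj_class G' P"
      using h P0 g' conj_class_conj[OF G' h(1), of P0] by (auto simp: hyperbolic_conj)
    have "\<D> C = conj_class G ` (conj_class G' P \<inter> G)"
    proof (intro equalityI subsetI)
      fix D assume "D \<in> \<D> C"
      then obtain Q where "Q \<in> G" "D = conj_class G Q" "D \<subseteq> C"
        by (auto simp: \<D>_def hyperbolic_classes_def)
      then show "D \<in> conj_class G ` (conj_class G' P \<inter> G)"
        using mem_conj_class[OF G g(1)] P(3) by blast
    next
      fix D assume "D \<in> conj_class G ` (conj_class G' P \<inter> G)"
      then obtain Q where Q: "Q \<in> G" "Q \<in> conj_class G' P" "D = conj_class G Q" by auto
      have "hyperbolic Q" using Q(2) P(2) g'(1) hyperbolic_conj by (auto simp: conj_class_def)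
      moreover have "conj_class G Q \<subseteq> conj_class G' Q" using sub by (auto simp: conj_class_def)
      ultimately show "D \<in> \<D> C"
        using Q conj_class_eqI[OF G' Q(2)] P(3) by (auto simp: \<D>_def hyperbolic_classes_def)
    qed
    then show ?thesis
      using z_term_induced[OF G G' sub disc fin \<rho> P(1,2)]
      by (simp add: z_class_term_def P_def)
  qed
  then have z_eq: "z_class_term G' (induced_rep G G' \<rho>) s C = (\<Sum>D\<in>\<D> C. z_class_term G \<rho> s D)"
    and fin\<D>: "finite (\<D> C)" if "C \<in> ?A'" for C using that by auto
  have bij: "bij_betw snd (Sigma ?A' \<D>) ?A"
  proof (rule bij_betwI')
    fix p q assume p: "p \<in> Sigma ?A' \<D>" and q: "q \<in> Sigma ?A' \<D>"
    show "snd p = snd q \<longleftrightarrow> p = q"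
    proof
      assume eq: "snd p = snd q"
      obtain Q where Q: "Q \<in> G" "snd p = conj_class G Q"
        using p by (auto simp: \<D>_def hyperbolic_classes_def)
      have Qp: "Q \<in> snd p" using mem_conj_class[OF G g(1)[OF Q(1)]] Q by simp
      have "fst r = conj_class G' Q" if r: "r \<in> Sigma ?A' \<D>" "Q \<in> snd r" for r
      proof -
        obtain P where "fst r = conj_class G' P" using r by (auto simp: hyperbolic_classes_def)
        moreover have "Q \<in> fst r" using r by (auto simp: \<D>_def)
        ultimately show ?thesis using conj_class_eqI[OF G'] by metis
      qed
      then show "p = q" using p q Qp eq by (metis prod_eqI)
    qed simp
  next
    fix D assume D: "D \<in> ?A"
    then obtain Q where Q: "Q \<in> G" "hyperbolic Q" "D = conj_class G Q"
      by (auto simp: hyperbolic_classes_def)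
    then have "(conj_class G' Q, D) \<in> Sigma ?A' \<D>"
      using D sub by (auto simp: \<D>_def hyperbolic_classes_def) (auto simp: conj_class_def)
    then show "\<exists>p\<in>Sigma ?A' \<D>. D = snd p" by (metis snd_conv)
  qed (auto simp: \<D>_def)
  have norm_Sigma: "(\<lambda>p. norm (z_class_term G \<rho> s (snd p))) summable_on Sigma ?A' \<D>"
    using summable summable_on_reindex_bij_betw[OF bij, where f = "\<lambda>D. norm (z_class_term G \<rho> s D)"] by simp
  then have "(\<lambda>C. infsum (\<lambda>D. norm (z_class_term G \<rho> s D)) (\<D> C)) summable_on ?A'"
    using summable_on_Sigma_banach[where f = "\<lambda>_ D. norm (z_class_term G \<rho> s D)" and A = ?A' and B = \<D>]
    by (simp add: case_prod_unfold)
  then show "(\<lambda>C. norm (z_class_term G' (induced_rep G G' \<rho>) s C)) summable_on ?A'"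
    by (rule summable_on_comparison_test) (simp_all add: z_eq fin\<D> norm_sum)
  have "(\<lambda>p. z_class_term G \<rho> s (snd p)) summable_on Sigma ?A' \<D>"
    using norm_Sigma by (rule abs_summable_summable)
  then have "infsum (\<lambda>C. infsum (\<lambda>D. z_class_term G \<rho> s D) (\<D> C)) ?A' =
      infsum (\<lambda>p. z_class_term G \<rho> s (snd p)) (Sigma ?A' \<D>)"
    using infsum_Sigma_banach[where f = "\<lambda>p. z_class_term G \<rho> s (snd p)" and A = ?A' and B = \<D>]
    by simp
  also have "\<dots> = infsum (z_class_term G \<rho> s) ?A"
    by (rule infsum_reindex_bij_betw[OF bij])
  finally show "z_series G' (induced_rep G G' \<rho>) s = z_series G \<rho> s"
    unfolding z_series_def by (simp add: z_eq fin\<D> cong: infsum_cong)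
qed

theorem theorem1:
  fixes \<Gamma> \<Gamma>' :: "cmat2 set" and \<psi> :: "'v::ab_group_add crep"
  assumes "subgroup \<Gamma> SL2C" and "subgroup \<Gamma>' SL2C" and "\<Gamma> \<subseteq> \<Gamma>'"
    and "discrete \<Gamma>" and "discrete \<Gamma>'"
    and "{mat 1, - mat 1} \<subseteq> \<Gamma>" and "{mat 1, - mat 1} \<subseteq> \<Gamma>'"
    and "finite_covolume \<Gamma>"
    and "finite (rcosets\<^bsub>SL2C\<lparr>carrier := \<Gamma>'\<rparr>\<^esub> \<Gamma>)"
    and "unitary_rep \<Gamma> \<psi>"
    and "z_well_defined \<Gamma> \<psi>"
  shows "z_well_defined \<Gamma>' (induced_rep \<Gamma> \<Gamma>' \<psi>) \<and>
         (\<forall>s. z_fun \<Gamma> \<psi> s = z_fun \<Gamma>' (induced_rep \<Gamma> \<Gamma>' \<psi>) s)"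
proof -
  let ?\<pi> = "induced_rep \<Gamma> \<Gamma>' \<psi>"
  have wd: "(\<lambda>C. norm (z_class_term \<Gamma> \<psi> s C)) summable_on hyperbolic_classes \<Gamma>" if "Re s > 1" for s
    using assms(11) that by (simp add: z_well_defined_def)
  note series = z_series_induced[OF assms(1,2,3,5,9,10) wd]
  have "is_z_continuation \<Gamma>' ?\<pi> = is_z_continuation \<Gamma> \<psi>"
    using series(2) by (auto simp: is_z_continuation_def fun_eq_iff)
  then show ?thesis
    using series(1) assms(11) by (simp add: z_well_defined_def z_fun_def)
qed

end
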